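(* Let $X$ be a finite regular cellular decomposition of a (closed, connected) oriented surface $M_g$ of genus $g$, and let $(X,p)$ be a diagram realizing $X$ in $\mathbb{R}^2$. If the dimension of the space $H_1\mathcal F$ of axial self stresses of $(X,p)$ is greater than $6g$, then there exist a self stress $w\in H_1\mathcal F$ and a non-trivial polyhedral lifting $h=(h_f)_f$ of $(X,p)$ to $\mathbb{R}^3$ for which the difference in gradient between adjacent lifted faces is equal to the force within the connecting edge; that is, $$[e:f]\,(\nabla h_f-\nabla h_k)=w_e\,J\tau_e$$ for each edge $e$ of $X$ with incident faces $f,k$, where $J(x,y)=(y,-x)$ is a quarter turn of the plane.
   Context: **Cells.** A regular cell complex has cells that are topological disks whose boundaries consist of incident lower dimensional cells; $c\lhd d$ denotes that $c$ is a cell in the boundary of $d$. A signed incidence relation $[c:d]\in\{-1,0,1\}$ is fixed, nonzero iff $c\lhd d$ and $\dim d=\dim c+1$, with $[u:e][v:e]=-1$ for the two endpoints $u,v$ of an edge $e$, and $\sum_c[b:c][c:d]=0$ for all $b\lhd d$; it is induced by local orientations of cells, with all faces oriented consistently with the orientation of the surface (so $[e:f]=-[e:k]$ if $f,k$ are the two faces at $e$). **Diagram.** A diagram $(X,p)$ in $\mathbb{R}^2$ is $X$ with an injective map $p$ from its vertex set to $\mathbb{R}^2$, $v\mapsto p_v$. Edges and faces may overlap in the plane. For an edge $e$ with endpoints $u,v$, $\tau_e$ denotes the unit vector in the direction of $[u:e]p_u+[v:e]p_v$. **Self stress.** $H_1\mathcal F$ is the first homology of the force cosheaf, i.e. the kernel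 of $\partial:\mathbb{R}^E\to(\mathbb{R}^2)^V$, $(\partial w)_v=\sum_{e:\,v\lhd e}[v:e]\,w_e\,\tau_e$, where $V,E$ are the vertex and edge sets of $X$; $w_e$ is the (signed) force in the edge $e$. **Polyhedral lifting.** A polyhedral lifting of $(X,p)$ to $\mathbb{R}^3$ is an assignment of an affine function $h_f:\mathbb{R}^2\to\mathbb{R}$ to each face $f$ of $X$ such that for every edge $e$ with endpoints $u,v$ and incident faces $f,k$ one has $h_f(p_u)=h_k(p_u)$ and $h_f(p_v)=h_k(p_v)$ (the lifted face is the graph of $h_f$ over $f$). It is non-trivial if it is not given by a single global affine function, i.e. not all $h_f$ are equal. *)

theory Defs
  imports "HOL-Analysis.Analysis" "HOL-Analysis.Finite_Function_Topology"
begin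

section \<open>Regular cell complexes of dimension at most two\<close>

text \<open>
  A cell is represented by the \<^emph>\<open>open\<close> cell, as a point set of the underlying space; the
  open cells partition the space. The signed incidence relation \<open>[c:d]\<close> is part of the
  data, as \<open>incid X c d\<close>.
\<close>

record 'a cell_complex =
  underlying :: "'a topology"
  cells :: "'a set set"
  cdim :: "'a set \<Rightarrow> nat"
  incid :: "'a set \<Rightarrow> 'a set \<Rightarrow> int"

definition disk_cell :: "'b::euclidean_space itself \<Rightarrow> 'a topology \<Rightarrow> 'a set \<Rightarrow> bool" where
  "disk_cell B T c \<longleftrightarrow>
     (\<exists>\<phi>. homeomorphic_map (top_of_set (cball (0::'b) 1)) (subtopology T (T closure_of c)) \<phi> \<and>
          \<phi> ` ball 0 1 = c)"

definition is_cell :: "'a topology \<Rightarrow> nat \<Rightarrow> 'a set \<Rightarrow> bool" where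
  "is_cell T n c \<longleftrightarrow>
     (n = 0 \<and> (\<exists>x \<in> topspace T. c = {x})) \<or>
     (n = 1 \<and> disk_cell TYPE(real) T c) \<or>
     (n = 2 \<and> disk_cell TYPE(real \<times> real) T c)"

text \<open>The relation \<open>c \<lhd> d\<close>.\<close>

definition bd_cell :: "('a, 'm) cell_complex_scheme \<Rightarrow> 'a set \<Rightarrow> 'a set \<Rightarrow> bool" where
  "bd_cell X c d \<longleftrightarrow> c \<in> cells X \<and> d \<in> cells X \<and> c \<noteq> d \<and> c \<subseteq> underlying X closure_of d"

definition regular_cell_complex :: "('a, 'm) cell_complex_scheme \<Rightarrow> bool" where
  "regular_cell_complex X \<longleftrightarrow>
     \<Union> (cells X) = topspace (underlying X) \<and>
     disjoint (cells X) \<and>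
     (\<forall>c \<in> cells X. is_cell (underlying X) (cdim X c) c) \<and>
     (\<forall>c \<in> cells X. \<forall>d \<in> cells X.
        c \<noteq> d \<and> c \<inter> (underlying X closure_of d) \<noteq> {} \<longrightarrow>
        c \<subseteq> underlying X closure_of d \<and> cdim X c < cdim X d)"

definition verts :: "('a, 'm) cell_complex_scheme \<Rightarrow> 'a set set" where
  "verts X = {c \<in> cells X. cdim X c = 0}"

definition edges :: "('a, 'm) cell_complex_scheme \<Rightarrow> 'a set set" where
  "edges X = {c \<in> cells X. cdim X c = 1}"

definition faces :: "('a, 'm) cell_complex_scheme \<Rightarrow> 'a set set" where
  "faces X = {c \<in> cells X. cdim X c = 2}"

definition signed_incidence :: "('a, 'm) cell_complex_scheme \<Rightarrow> bool" where
  "signed_incidence X \<longleftrightarrow>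
     (\<forall>c \<in> cells X. \<forall>d \<in> cells X.
        incid X c d \<in> {-1, 0, 1} \<and>
        (incid X c d \<noteq> 0 \<longleftrightarrow> bd_cell X c d \<and> cdim X d = cdim X c + 1)) \<and>
     (\<forall>e \<in> edges X. \<forall>u \<in> verts X. \<forall>v \<in> verts X.
        u \<noteq> v \<and> bd_cell X u e \<and> bd_cell X v e \<longrightarrow> incid X u e * incid X v e = -1) \<and>
     (\<forall>b d. bd_cell X b d \<longrightarrow> (\<Sum>c \<in> cells X. incid X b c * incid X c d) = 0)"

text \<open>All faces are oriented consistently with an orientation of the surface.\<close>

definition coherently_oriented :: "('a, 'm) cell_complex_scheme \<Rightarrow> bool" where
  "coherently_oriented X \<longleftrightarrow>
     (\<forall>e \<in> edges X. \<forall>f \<in> faces X. \<forall>k \<in> faces X.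
        f \<noteq> k \<and> bd_cell X e f \<and> bd_cell X e k \<longrightarrow> incid X e f = - incid X e k)"


section \<open>Closed oriented surfaces and their genus\<close>

text \<open>
  Second countability is not listed: it follows from compactness and the existence of charts.
\<close>

definition closed_surface :: "'a topology \<Rightarrow> bool" where
  "closed_surface T \<longleftrightarrow>
     topspace T \<noteq> {} \<and> compact_space T \<and> connected_space T \<and> Hausdorff_space T \<and>
     (\<forall>x \<in> topspace T. \<exists>U. \<exists>W :: (real \<times> real) set.
        openin T U \<and> x \<in> U \<and> open W \<and> subtopology T U homeomorphic_space top_of_set W)"

definition euler_char :: "('a, 'm) cell_complex_scheme \<Rightarrow> int" where
  "euler_char X = int (card (verts X)) - int (card (edges X)) + int (card (faces X))"

text \<open>
  The genus of a closed oriented surface is read off from its Euler characteristic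
  \<open>2 - 2 g\<close>, computed from the given finite cell decomposition.
\<close>

definition oriented_surface_decomposition ::
    "('a, 'm) cell_complex_scheme \<Rightarrow> nat \<Rightarrow> bool" where
  "oriented_surface_decomposition X g \<longleftrightarrow>
     closed_surface (underlying X) \<and> finite (cells X) \<and> regular_cell_complex X \<and>
     signed_incidence X \<and> coherently_oriented X \<and>
     euler_char X = 2 - 2 * int g"


section \<open>Diagrams, self stresses and polyhedral liftings\<close>

definition diagram :: "('a, 'm) cell_complex_scheme \<Rightarrow> ('a set \<Rightarrow> real \<times> real) \<Rightarrow> bool" where
  "diagram X p \<longleftrightarrow> inj_on p (verts X)"

definition edge_dir ::
    "('a, 'm) cell_complex_scheme \<Rightarrow> ('a set \<Rightarrow> real \<times> real) \<Rightarrow> 'a set \<Rightarrow> real \<times> real" where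
  "edge_dir X p e = sgn (\<Sum>v | v \<in> verts X \<and> bd_cell X v e. of_int (incid X v e) *\<^sub>R p v)"

text \<open>
  \<open>H\<^sub>1 \<F>\<close>. The vector space of real functions on the edge set is the subspace of finitely
  supported functions with support in the edge set.
\<close>

definition self_stresses ::
    "('a, 'm) cell_complex_scheme \<Rightarrow> ('a set \<Rightarrow> real \<times> real) \<Rightarrow> ('a set \<Rightarrow>\<^sub>0 real) set" where
  "self_stresses X p =
     {w. Poly_Mapping.keys w \<subseteq> edges X \<and>
         (\<forall>v \<in> verts X.
            (\<Sum>e | e \<in> edges X \<and> bd_cell X v e.
               (of_int (incid X v e) * Poly_Mapping.lookup w e) *\<^sub>R edge_dir X p e) = 0)}"

definition affine_function :: "(real \<times> real \<Rightarrow> real) \<Rightarrow> bool" where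
  "affine_function h \<longleftrightarrow> (\<exists>a b. \<forall>x. h x = a \<bullet> x + b)"

definition polyhedral_lifting ::
    "('a, 'm) cell_complex_scheme \<Rightarrow> ('a set \<Rightarrow> real \<times> real) \<Rightarrow>
     ('a set \<Rightarrow> real \<times> real \<Rightarrow> real) \<Rightarrow> bool" where
  "polyhedral_lifting X p h \<longleftrightarrow>
     (\<forall>f \<in> faces X. affine_function (h f)) \<and>
     (\<forall>e \<in> edges X. \<forall>f \<in> faces X. \<forall>k \<in> faces X. \<forall>v \<in> verts X.
        bd_cell X e f \<and> bd_cell X e k \<and> bd_cell X v e \<longrightarrow> h f (p v) = h k (p v))"

definition nontrivial_lifting ::
    "('a, 'm) cell_complex_scheme \<Rightarrow> ('a set \<Rightarrow> real \<times> real \<Rightarrow> real) \<Rightarrow> bool" where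
  "nontrivial_lifting X h \<longleftrightarrow> (\<exists>f \<in> faces X. \<exists>k \<in> faces X. h f \<noteq> h k)"

definition gradient :: "('b::real_inner \<Rightarrow> real) \<Rightarrow> 'b \<Rightarrow> 'b" where
  "gradient h x = (THE D. GDERIV h x :> D)"

definition quarter_turn :: "real \<times> real \<Rightarrow> real \<times> real" where
  "quarter_turn z = (snd z, - fst z)"

end

theory Submission
  imports Defs
begin

text \<open>
  A self stress \<open>w\<close> turns into a lifting by integrating it over the faces. The prescribed jump
  of the gradient across an edge \<open>e\<close> is \<open>w\<^sub>e J\<tau>\<^sub>e\<close>, so the slopes \<open>(a\<^sub>f, b\<^sub>f)\<close> of the lifted
  faces have to satisfy \<open>\<partial>(a, b) = (w\<^sub>e J\<tau>\<^sub>e)\<^sub>e\<close>. For the lifted faces to meet over \<open>e\<close>, their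
  constant terms \<open>c\<^sub>f\<close> have to satisfy \<open>(\<partial>c)\<^sub>e = - w\<^sub>e J\<tau>\<^sub>e \<bullet> p\<^sub>v\<close>, where either end \<open>v\<close> of \<open>e\<close> may be
  taken because \<open>J\<tau>\<^sub>e\<close> is orthogonal to the edge. The three edge chains on the right are linear
  in \<open>w\<close>, and each is a cycle: at a vertex \<open>v\<close> its boundary is a fixed linear functional,
  depending only on \<open>v\<close>, applied to the sum of forces at \<open>v\<close>, which vanishes
  (\<open>weighted_stress_cycle\<close>). The obstruction to solving the three equations is therefore three
  classes in \<open>H\<^sub>1(X; \<real>)\<close>. As \<open>H\<^sub>1\<close> has dimension at most \<open>2g\<close> (\<open>homology_generators\<close>), a space of
  stresses of dimension greater than \<open>6g\<close> contains some \<open>w \<noteq> 0\<close> for which all three classes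
  vanish (\<open>bounding_stress\<close>). Every edge lies on two faces and has \<open>\<tau>\<^sub>e \<noteq> 0\<close>, so a lifting with
  all faces equal would force \<open>w = 0\<close>.

  The bound on \<open>H\<^sub>1\<close> follows from the Euler characteristic \<open>2 - 2g\<close> by counting dimensions, once
  three facts are extracted from the topology of the surface. Every edge lies on exactly two
  faces (\<open>edge_faces\<close>): with fewer, invariance of domain would be violated at a point of the
  edge, and with more, the orientations could not be coherent. The graph of vertices and edges
  is connected (\<open>verts_connected\<close>): the surface is connected and so is the boundary circle of
  each face. The dual graph is connected (\<open>faces_connected\<close>): the surface stays connected when
  the vertices are removed.
\<close>

section \<open>Counting dimensions\<close>

text \<open>
  The domain is a subspace of a space that may be infinite dimensional, so finite dimension
  enters through the finite spanning set \<open>T\<close>. A basis of the kernel is extended to a basis of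
  \<open>V\<close>; the added vectors are mapped injectively onto a basis of the image.
\<close>
lemma rank_nullity:
  fixes f :: "'b::real_vector \<Rightarrow> 'c::real_vector" and T V :: "'b set"
  assumes T: "finite T" "V \<subseteq> span T" and V: "subspace V" and f: "linear f"
  shows "dim V = dim {x \<in> V. f x = 0} + dim (f ` V)"
proof -
  interpret f: linear f by fact
  let ?K = "{x \<in> V. f x = 0}"
  have K: "subspace ?K"
    using V by (auto simp: subspace_def f.add f.scaleR f.zero)
  obtain B where B: "B \<subseteq> ?K" "independent B" "?K \<subseteq> span B" "card B = dim ?K"
    using basis_exists by blast
  obtain C where C: "B \<subseteq> C" "C \<subseteq> V" "independent C" "V \<subseteq> span C"
    using maximal_independent_subset_extend[OF _ B(2), of V] B(1) by blast
  have fin: "finite C"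
    using independent_span_bound[OF T(1) C(3)] C(2) T(2) by blast
  define D where "D = C - B"
  have C_eq: "C = B \<union> D" "B \<inter> D = {}" using C(1) by (auto simp: D_def)
  have indD: "independent D" using C(3) C_eq by (metis independent_mono sup_ge2)
  have spanD: "span D \<subseteq> V"
    using C(2) C_eq V by (metis le_sup_iff span_minimal)
  have inj: "inj_on f (span D)"
  proof (subst linear_inj_on_iff_eq_0[OF f subspace_span], intro ballI impI)
    fix x assume x: "x \<in> span D" "f x = 0"
    then have xB: "x \<in> span B" using spanD B(3) by blast
    have "representation C x = representation B x" "representation C x = representation D x"
      using C(1,3) C_eq(1) x(1) xB by (auto intro!: real_vector.representation_extend)
    then have "representation C x b = 0" for b
      using C_eq(2) representation_ne_zero by (metis IntI empty_iff)
    moreover have "x \<in> span C" using xB C(1) span_mono by blast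
    ultimately show "x = 0"
      using sum_nonzero_representation_eq[OF C(3)] by fastforce
  qed
  have "f ` V \<subseteq> span (f ` D)"
  proof
    fix y assume "y \<in> f ` V"
    then obtain x where x: "x \<in> span (B \<union> D)" "y = f x" using C C_eq by blast
    then obtain b d where "b \<in> span B" "d \<in> span D" "x = b + d"
      by (auto simp: span_Un)
    moreover have "span B \<subseteq> ?K" using B(1) K by (rule span_minimal)
    ultimately have "f x = f d" by (auto simp: f.add)
    then show "y \<in> span (f ` D)"
      using x(2) \<open>d \<in> span D\<close> linear_span_image[OF f, of D] by blast
  qed
  moreover have "f ` D \<subseteq> f ` V" using spanD span_base by blast
  moreover have "independent (f ` D)"
    using linear_independent_injective_image[OF f indD inj] .
  moreover have "card (f ` D) = card D"
    using inj by (meson card_image inj_on_subset span_superset)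
  ultimately have "dim (f ` V) = card D" using basis_card_eq_dim by metis
  moreover have "dim V = card C" using C basis_card_eq_dim by metis
  moreover have "card C = card B + card D"
    using C_eq fin by (metis card_Un_disjoint finite_Un)
  ultimately show ?thesis using B(4) by simp
qed

text \<open>
  If \<open>f\<close> maps \<open>S\<close> into a space that exceeds \<open>span B\<close> by \<open>card T\<close> dimensions, landing in \<open>span B\<close>
  imposes at most \<open>card T\<close> linear conditions. The generators in \<open>T\<close> are removed one at a
  time.
\<close>
lemma dim_preimage_ge:
  fixes f :: "'b::real_vector \<Rightarrow> 'c::real_vector"
  assumes "finite R" "S \<subseteq> span R" and S: "subspace S" and f: "linear f"
    and "finite T" "f ` S \<subseteq> span (B \<union> T)"
  shows "dim S \<le> dim {x \<in> S. f x \<in> span B} + card T"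
  using assms(5,2,3,6)
proof (induction T arbitrary: S)
  case empty
  then have "{x \<in> S. f x \<in> span B} = S" by auto
  then show ?case by simp
next
  case (insert t T)
  interpret f: linear f by fact
  define S1 where "S1 = {x \<in> S. f x \<in> span (B \<union> T)}"
  have S1: "subspace S1"
    using insert.prems(2) unfolding S1_def
    by (auto simp: subspace_def f.add f.scaleR f.zero span_add span_scale span_zero)
  have "dim S \<le> dim S1 + 1"
  proof (cases "S \<subseteq> S1")
    case True
    then have "S = S1" by (auto simp: S1_def)
    then show ?thesis by simp
  next
    case False
    then obtain w0 where w0: "w0 \<in> S" "f w0 \<notin> span (B \<union> T)" by (auto simp: S1_def)
    have brk: "\<exists>c. f w - c *\<^sub>R t \<in> span (B \<union> T)" if "w \<in> S" for w
      using that insert.prems by (auto simp: span_breakdown_eq)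
    obtain c0 where c0: "f w0 - c0 *\<^sub>R t \<in> span (B \<union> T)" using brk w0 by blast
    then have "c0 \<noteq> 0" using w0 by auto
    \<comment> \<open>Subtracting a multiple of \<open>w0\<close> cancels the \<open>t\<close>-component of any \<open>f w\<close>.\<close>
    have "S \<subseteq> span (insert w0 S1)"
    proof
      fix w assume w: "w \<in> S"
      obtain c where c: "f w - c *\<^sub>R t \<in> span (B \<union> T)" using brk w by blast
      have "f w - c *\<^sub>R t - (c / c0) *\<^sub>R (f w0 - c0 *\<^sub>R t) \<in> span (B \<union> T)"
        using c c0 by (simp add: span_diff span_scale)
      moreover have "f w - c *\<^sub>R t - (c / c0) *\<^sub>R (f w0 - c0 *\<^sub>R t) = f (w - (c / c0) *\<^sub>R w0)"
        using \<open>c0 \<noteq> 0\<close> by (simp add: f.diff f.scaleR scaleR_diff_right)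
      moreover have "w - (c / c0) *\<^sub>R w0 \<in> S"
        using w w0 insert.prems(2) by (simp add: subspace_diff subspace_scale)
      ultimately have "w - (c / c0) *\<^sub>R w0 \<in> S1"
        by (simp add: S1_def)
      then show "w \<in> span (insert w0 S1)" by (auto simp: span_breakdown_eq intro: span_base)
    qed
    moreover obtain C where C: "C \<subseteq> S1" "independent C" "S1 \<subseteq> span C" "card C = dim S1"
      using basis_exists by blast
    have "finite C"
      using independent_span_bound[OF assms(1) C(2)] C(1) insert.prems(1) by (auto simp: S1_def)
    moreover have "span (insert w0 S1) \<subseteq> span (insert w0 C)"
      using C(3) span_mono[OF subset_insertI, of C w0]
      by (intro span_minimal subspace_span) (auto intro: span_base)
    ultimately have "dim S \<le> card (insert w0 C)"
      by (intro dim_le_card) auto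
    also have "\<dots> \<le> dim S1 + 1" using C(4) \<open>finite C\<close> by (simp add: card_insert_if)
    finally show ?thesis .
  qed
  moreover have "dim S1 \<le> dim {x \<in> S1. f x \<in> span B} + card T"
    by (rule insert.IH) (use S1 insert.prems in \<open>auto simp: S1_def\<close>)
  moreover have "{x \<in> S1. f x \<in> span B} = {x \<in> S. f x \<in> span B}"
    using span_mono[of B "B \<union> T"] by (auto simp: S1_def)
  ultimately show ?case using insert.hyps by simp
qed

section \<open>Closed surfaces\<close>

text \<open>
  A locally constant labelling of a connected set is constant. It is phrased for finite closed
  covers because the closed cells, in contrast to the open ones, form such a cover.
\<close>
lemma connectedin_label_unique:
  assumes S: "connectedin T S" and I: "finite I"
    and closed: "\<And>i. i \<in> I \<Longrightarrow> closedin T (C i)"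
    and cover: "S \<subseteq> (\<Union>i\<in>I. C i)"
    and same: "\<And>i j. i \<in> I \<Longrightarrow> j \<in> I \<Longrightarrow> C i \<inter> C j \<inter> S \<noteq> {} \<Longrightarrow> l i = l j"
    and ij: "i \<in> I" "j \<in> I" "C i \<inter> S \<noteq> {}" "C j \<inter> S \<noteq> {}"
  shows "l i = l j"
proof (rule ccontr)
  assume neq: "l i \<noteq> l j"
  define E1 where "E1 = \<Union> (C ` {k \<in> I. l k = l i})"
  define E2 where "E2 = \<Union> (C ` {k \<in> I. l k \<noteq> l i})"
  have "closedin T E1" "closedin T E2"
    unfolding E1_def E2_def using I closed by (auto intro!: closedin_Union)
  moreover have "S \<subseteq> E1 \<union> E2" using cover unfolding E1_def E2_def by blast
  moreover have "E1 \<inter> E2 \<inter> S = {}" using same unfolding E1_def E2_def by fastforce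
  moreover have "E1 \<inter> S \<noteq> {}" using ij unfolding E1_def by blast
  moreover have "E2 \<inter> S \<noteq> {}" using ij neq unfolding E2_def by force
  ultimately show False using S unfolding connectedin_closedin by blast
qed

lemma surface_disk_nhd:
  assumes "closed_surface T" "openin T N" "x \<in> N"
  obtains \<beta> :: "real \<times> real \<Rightarrow> 'a" and c r D where "r > 0" "\<beta> c = x" "openin T D" "D \<subseteq> N"
    "homeomorphic_map (top_of_set (ball c r)) (subtopology T D) \<beta>"
proof -
  have "x \<in> topspace T" using assms(2,3) openin_subset by blast
  then obtain U and W :: "(real \<times> real) set" where U: "openin T U" "x \<in> U" "open W"
    "subtopology T U homeomorphic_space top_of_set W"
    using assms(1) unfolding closed_surface_def by blast
  then obtain q q' where q: "homeomorphic_maps (subtopology T U) (top_of_set W) q q'"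
    unfolding homeomorphic_space_def by blast
  have hq: "homeomorphic_map (subtopology T U) (top_of_set W) q"
    and hq': "homeomorphic_map (top_of_set W) (subtopology T U) q'"
    using q homeomorphic_maps_map by blast+
  have topU: "topspace (subtopology T U) = U"
    using U(1) openin_subset by auto
  have inv: "\<And>y. y \<in> U \<Longrightarrow> q y \<in> W \<and> q' (q y) = y"
    using q topU homeomorphic_imp_surjective_map[OF hq] unfolding homeomorphic_maps_def by auto
  have "openin (subtopology T U) (N \<inter> U)"
    using assms(2) by (metis openin_subtopology_Int)
  then have "openin (top_of_set W) (q ` (N \<inter> U))"
    using homeomorphic_imp_open_map[OF hq] unfolding open_map_def by blast
  then have "open (q ` (N \<inter> U))" using U(3) openin_open_eq by blast
  then obtain r where r: "r > 0" "ball (q x) r \<subseteq> q ` (N \<inter> U)"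
    using assms(3) U(2) by (metis IntI image_eqI openE)
  have sub: "ball (q x) r \<subseteq> W" using r inv by blast
  define D where "D = q' ` ball (q x) r"
  have "openin (subtopology T U) D"
    unfolding D_def using homeomorphic_imp_open_map[OF hq'] sub U(3)
    unfolding open_map_def by (metis open_ball openin_open_eq)
  then have D: "openin T D" "D \<subseteq> U" using U(1) openin_trans_full openin_imp_subset by blast+
  have "homeomorphic_map (subtopology (top_of_set W) (ball (q x) r)) (subtopology (subtopology T U) D) q'"
    using sub D topU by (intro homeomorphic_map_subtopologies[OF hq']) (auto simp: D_def Int_absorb1)
  then have "homeomorphic_map (top_of_set (ball (q x) r)) (subtopology T D) q'"
    using sub D by (simp add: subtopology_subtopology Int_absorb1)
  moreover have "D \<subseteq> N" using r inv unfolding D_def by force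
  ultimately show ?thesis
    using that[of r q' "q x" D] r D inv U(2) by blast
qed

text \<open>
  Invariance of domain, transported to the surface by a chart. It is what rules out edges
  with fewer than two faces.
\<close>
lemma surface_injection_interior:
  fixes \<psi> :: "'a \<Rightarrow> real \<times> real"
  assumes "closed_surface T" "openin T N" "x \<in> N"
    and cont: "continuous_map (subtopology T N) euclidean \<psi>" and inj: "inj_on \<psi> N"
  shows "\<psi> x \<in> interior (\<psi> ` N)"
proof -
  obtain \<beta> and c :: "real \<times> real" and r D where \<beta>: "r > 0" "\<beta> c = x" "openin T D" "D \<subseteq> N"
    "homeomorphic_map (top_of_set (ball c r)) (subtopology T D) \<beta>"
    by (rule surface_disk_nhd[OF assms(1-3)])
  have topD: "topspace (subtopology T D) = D" using \<beta>(3) openin_subset by auto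
  have im: "\<beta> ` ball c r = D"
    using homeomorphic_imp_surjective_map[OF \<beta>(5)] topD by simp
  have "continuous_map (subtopology T D) euclidean \<psi>"
    using cont \<beta>(4) continuous_map_from_subtopology_mono by blast
  then have "continuous_map (top_of_set (ball c r)) euclidean (\<psi> \<circ> \<beta>)"
    using homeomorphic_imp_continuous_map[OF \<beta>(5)] continuous_map_compose by blast
  then have "continuous_on (ball c r) (\<psi> \<circ> \<beta>)" by (simp del: o_apply)
  moreover have "inj_on (\<psi> \<circ> \<beta>) (ball c r)"
    using homeomorphic_imp_injective_map[OF \<beta>(5)] im inj \<beta>(4)
    by (intro comp_inj_on) (auto intro: inj_on_subset)
  ultimately have "open ((\<psi> \<circ> \<beta>) ` ball c r)"
    by (intro invariance_of_domain open_ball)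
  moreover have "(\<psi> \<circ> \<beta>) ` ball c r \<subseteq> \<psi> ` N" using im \<beta>(4) by auto
  moreover have "\<psi> x \<in> (\<psi> \<circ> \<beta>) ` ball c r" using \<beta>(1,2) by force
  ultimately show ?thesis using interiorI by blast
qed

text \<open>
  A separation of the complement of a point \<open>v\<close> would leave a small punctured disk around \<open>v\<close>,
  which is connected, on one side; putting \<open>v\<close> back on that side would separate the set before
  the removal.
\<close>
lemma connectedin_surface_minus_finite:
  assumes T: "closed_surface T" and "finite S"
  shows "connectedin T (topspace T - S)"
  using assms(2)
proof (induction S)
  case empty
  then show ?case using T by (simp add: closed_surface_def connectedin_topspace)
next
  case (insert v S)
  have haus: "Hausdorff_space T" using T by (simp add: closed_surface_def)
  let ?M = "topspace T - S"
  have fin_open: "openin T (topspace T - R)" if "finite R" for R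
  proof -
    have "closedin T (topspace T \<inter> R)"
      using that Hausdorff_imp_t1_space[OF haus] by (simp add: t1_space_closedin_finite)
    moreover have "topspace T - R = topspace T - (topspace T \<inter> R)" by blast
    ultimately show ?thesis by (simp only: openin_diff openin_topspace)
  qed
  have M: "openin T ?M" using fin_open insert.hyps(1) .
  have M': "openin T (?M - {v})"
  proof -
    have "openin T (topspace T - insert v S)" by (rule fin_open) (simp add: insert.hyps(1))
    then show ?thesis by (simp only: Diff_insert[of _ v S])
  qed
  show ?case
  proof (cases "v \<in> ?M")
    case False
    then have "topspace T - insert v S = ?M" by auto
    then show ?thesis using insert.IH by simp
  next
    case True
    obtain \<beta> and c :: "real \<times> real" and r D where \<beta>: "r > 0" "\<beta> c = v" "openin T D" "D \<subseteq> ?M"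
      "homeomorphic_map (top_of_set (ball c r)) (subtopology T D) \<beta>"
      by (rule surface_disk_nhd[OF T M True])
    have topD: "topspace (subtopology T D) = D" using \<beta>(3) openin_subset by auto
    have im: "\<beta> ` ball c r = D"
      using homeomorphic_imp_surjective_map[OF \<beta>(5)] topD by simp
    have inj: "inj_on \<beta> (ball c r)" using homeomorphic_imp_injective_map[OF \<beta>(5)] by simp
    have "c \<in> ball c r" using \<beta>(1) by simp
    then have "v \<in> D" using im \<beta>(2) by blast
    have "connectedin (top_of_set (ball c r)) (ball c r - {c})"
      by (auto simp: connectedin_subtopology intro!: connected_punctured_ball)
    then have "connectedin (subtopology T D) (\<beta> ` (ball c r - {c}))"
      using homeomorphic_imp_continuous_map[OF \<beta>(5)] connectedin_continuous_map_image by blast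
    moreover have "\<beta> ` (ball c r - {c}) = D - {v}"
      using inj im \<beta>(2) \<open>c \<in> ball c r\<close> by (auto simp: inj_on_def)
    ultimately have conn: "connectedin T (D - {v})" by (simp add: connectedin_subtopology)
    show ?thesis
    proof (rule ccontr)
      assume "\<not> ?thesis"
      moreover have "topspace T - insert v S = ?M - {v}" by auto
      ultimately have "\<not> connectedin T (?M - {v})" by argo
      then obtain A B where AB: "openin T A" "openin T B" "?M - {v} \<subseteq> A \<union> B"
        "A \<inter> B \<inter> (?M - {v}) = {}" "A \<inter> (?M - {v}) \<noteq> {}" "B \<inter> (?M - {v}) \<noteq> {}"
        using openin_subset[OF M'] unfolding connectedin by blast
      have no: False
        if AB: "openin T A" "openin T B" "?M - {v} \<subseteq> A \<union> B"
          "A \<inter> B \<inter> (?M - {v}) = {}" "A \<inter> (?M - {v}) \<noteq> {}" "B \<inter> (?M - {v}) \<noteq> {}"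
          and D: "B \<inter> (D - {v}) = {}" for A B
      proof -
        have "openin T (A \<union> D)" "openin T (B \<inter> (?M - {v}))" using AB \<beta>(3) M' by auto
        moreover have "?M \<subseteq> (A \<union> D) \<union> (B \<inter> (?M - {v}))" using AB(3) \<open>v \<in> D\<close> by blast
        moreover have "(A \<union> D) \<inter> (B \<inter> (?M - {v})) \<inter> ?M = {}" using AB(4) D by blast
        moreover have "(A \<union> D) \<inter> ?M \<noteq> {}" "(B \<inter> (?M - {v})) \<inter> ?M \<noteq> {}" using AB(5,6) by blast+
        ultimately show False using insert.IH unfolding connectedin by blast
      qed
      \<comment> \<open>The roles of \<open>A\<close> and \<open>B\<close> may be exchanged, so it does not matter on which side the punctured disk lies.\<close>
      have "D - {v} \<subseteq> A \<union> B" "A \<inter> B \<inter> (D - {v}) = {}" using AB(3,4) \<beta>(4) by blast+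
      then have "A \<inter> (D - {v}) = {} \<or> B \<inter> (D - {v}) = {}"
        using conn AB(1,2) unfolding connectedin by blast
      then show False using no[of A B] no[of B A] AB by (auto simp: Un_commute Int_commute)
    qed
  qed
qed

lemma disk_cell_param:
  assumes "disk_cell TYPE('b::euclidean_space) T c"
  obtains \<phi> where
    "homeomorphic_map (top_of_set (cball (0::'b) 1)) (subtopology T (T closure_of c)) \<phi>"
    "inj_on \<phi> (cball 0 1)" "\<phi> ` ball 0 1 = c" "\<phi> ` cball 0 1 = T closure_of c"
    "\<phi> ` sphere 0 1 = T closure_of c - c"
proof -
  obtain \<phi> where \<phi>: "homeomorphic_map (top_of_set (cball (0::'b) 1)) (subtopology T (T closure_of c)) \<phi>"
    "\<phi> ` ball 0 1 = c" using assms unfolding disk_cell_def by blast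
  have inj: "inj_on \<phi> (cball 0 1)" using homeomorphic_imp_injective_map[OF \<phi>(1)] by simp
  have im: "\<phi> ` cball 0 1 = T closure_of c"
    using homeomorphic_imp_surjective_map[OF \<phi>(1)] by (auto simp: closure_of_subset_topspace Int_absorb1)
  have "\<phi> ` (cball 0 1 - ball 0 1) = \<phi> ` cball 0 1 - \<phi> ` ball 0 1"
    by (rule inj_on_image_set_diff[OF inj]) auto
  moreover have "cball 0 1 - ball 0 1 = sphere (0::'b) 1" by auto
  ultimately show ?thesis using that \<phi> inj im by metis
qed

lemma disk_cell_nonempty: "disk_cell TYPE('b::euclidean_space) T c \<Longrightarrow> c \<noteq> {}"
  unfolding disk_cell_def by force

section \<open>Incidence of cells\<close>

locale surface_decomposition =
  fixes X :: "('a, 'm) cell_complex_scheme" and g :: nat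
  assumes decomposition: "oriented_surface_decomposition X g"
begin

abbreviation cl :: "'a set \<Rightarrow> 'a set" where
  "cl c \<equiv> underlying X closure_of c"

lemma surface: "closed_surface (underlying X)"
  and finite_cells: "finite (cells X)"
  and regular: "regular_cell_complex X"
  and incidence: "signed_incidence X"
  and orientation: "coherently_oriented X"
  using decomposition by (simp_all add: oriented_surface_decomposition_def)

lemma hausdorff: "Hausdorff_space (underlying X)"
  using surface by (simp add: closed_surface_def)

lemma finite_verts: "finite (verts X)" and finite_edges: "finite (edges X)"
  and finite_faces: "finite (faces X)"
  using finite_cells by (auto simp: verts_def edges_def faces_def)

lemma is_cell: "c \<in> cells X \<Longrightarrow> is_cell (underlying X) (cdim X c) c"
  using regular by (auto simp: regular_cell_complex_def)

lemma cell_nonempty: "c \<in> cells X \<Longrightarrow> c \<noteq> {}"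
  using is_cell[of c] by (auto simp: is_cell_def dest: disk_cell_nonempty)

lemma cells_cover: "\<Union> (cells X) = topspace (underlying X)"
  using regular by (simp add: regular_cell_complex_def)

lemma cell_subset_cl: "c \<in> cells X \<Longrightarrow> c \<subseteq> cl c"
  using cells_cover by (intro closure_of_subset) auto

lemma cell_eqI:
  assumes "c \<in> cells X" "d \<in> cells X" "x \<in> c" "x \<in> d"
  shows "c = d"
proof -
  have "disjoint (cells X)" using regular by (simp add: regular_cell_complex_def)
  then show ?thesis using assms by (auto simp: disjoint_def)
qed

lemma in_cl_cell:
  assumes "c \<in> cells X" "d \<in> cells X" "x \<in> c" "x \<in> cl d"
  shows "c = d \<or> (bd_cell X c d \<and> cdim X c < cdim X d)"
proof -
  have "\<forall>c \<in> cells X. \<forall>d \<in> cells X. c \<noteq> d \<and> c \<inter> cl d \<noteq> {} \<longrightarrow> c \<subseteq> cl d \<and> cdim X c < cdim X d"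
    using regular by (simp add: regular_cell_complex_def)
  moreover have "c \<inter> cl d \<noteq> {}" using assms by blast
  ultimately show ?thesis using assms(1,2) unfolding bd_cell_def by metis
qed

lemma in_cl_ex_cell: "x \<in> cl d \<Longrightarrow> \<exists>c\<in>cells X. x \<in> c"
  using closure_of_subset_topspace[of "underlying X" d] unfolding cells_cover[symmetric] by blast

lemma bd_cell_cdim:
  assumes "bd_cell X c d"
  shows "cdim X c < cdim X d"
proof -
  have cd: "c \<in> cells X" "d \<in> cells X" "c \<noteq> d" "c \<subseteq> cl d" using assms by (auto simp: bd_cell_def)
  obtain x where "x \<in> c" using cell_nonempty[OF cd(1)] by blast
  then show ?thesis using in_cl_cell[OF cd(1,2), of x] cd by auto
qed

lemma bd_cell_cl: "bd_cell X c d \<Longrightarrow> cl c \<subseteq> cl d"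
  unfolding bd_cell_def by (simp add: closure_of_minimal)

lemma bd_cell_trans:
  assumes "bd_cell X b c" "bd_cell X c d"
  shows "bd_cell X b d"
  using assms bd_cell_cl[OF assms(2)] bd_cell_cdim[OF assms(1)] bd_cell_cdim[OF assms(2)]
  by (auto simp: bd_cell_def)

lemma cdim_le_2: "c \<in> cells X \<Longrightarrow> cdim X c \<le> 2"
  using is_cell[of c] by (auto simp: is_cell_def)

lemma vert_point: "v \<in> verts X \<Longrightarrow> \<exists>x\<in>topspace (underlying X). v = {x}"
  using is_cell[of v] by (auto simp: verts_def is_cell_def)

lemma cl_vert:
  assumes "v \<in> verts X"
  shows "cl v = v"
proof -
  obtain x where "x \<in> topspace (underlying X)" "v = {x}" using vert_point[OF assms] by blast
  then show ?thesis using closedin_Hausdorff_singleton[OF hausdorff] by (simp add: closure_of_closedin)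
qed

lemma incid_eq_0_iff:
  assumes "c \<in> cells X" "d \<in> cells X"
  shows "incid X c d = 0 \<longleftrightarrow> \<not> (bd_cell X c d \<and> cdim X d = cdim X c + 1)"
  using incidence assms by (auto simp: signed_incidence_def)

lemma incid_faces:
  assumes "e \<in> edges X" "f \<in> faces X" "k \<in> faces X" "f \<noteq> k" "bd_cell X e f" "bd_cell X e k"
  shows "incid X e k = - incid X e f"
proof -
  have "incid X e f = - incid X e k"
    using orientation assms unfolding coherently_oriented_def by blast
  then show ?thesis by simp
qed

text \<open>
  The boundary of an edge is the image of the \<open>0\<close>-sphere, which has two points. The cells
  containing them have smaller dimension, hence are vertices.
\<close>
lemma edge_endpoints:
  assumes e: "e \<in> edges X"
  obtains u v where "u \<noteq> v" "{x \<in> verts X. bd_cell X x e} = {u, v}"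
proof -
  have ec: "e \<in> cells X" "cdim X e = 1" using e by (auto simp: edges_def)
  then have "disk_cell TYPE(real) (underlying X) e" using is_cell[of e] by (simp add: is_cell_def)
  then obtain \<phi> where \<phi>: "inj_on \<phi> (cball (0::real) 1)" "\<phi> ` sphere 0 1 = cl e - e"
    by (rule disk_cell_param)
  have "sphere (0::real) 1 = {-1, 1}" by auto
  then have ab: "cl e - e = {\<phi> (-1), \<phi> 1}" using \<phi>(2) by auto
  have "\<phi> (-1) \<noteq> \<phi> 1" using \<phi>(1) by (auto dest: inj_onD)
  have vert: "{a} \<in> verts X \<and> bd_cell X {a} e" if a: "a \<in> cl e - e" for a
  proof -
    obtain c where c: "c \<in> cells X" "a \<in> c" using a in_cl_ex_cell by blast
    then have "bd_cell X c e" "cdim X c < 1" using in_cl_cell[OF c(1) ec(1) c(2)] a ec(2) by auto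
    then have "c \<in> verts X" using c by (simp add: verts_def)
    moreover from this c(2) have "c = {a}" using vert_point by blast
    ultimately show ?thesis using \<open>bd_cell X c e\<close> by simp
  qed
  have "x \<in> {{\<phi> (-1)}, {\<phi> 1}}" if x: "x \<in> verts X" "bd_cell X x e" for x
  proof -
    obtain z where z: "x = {z}" using vert_point x by blast
    then have "z \<in> cl e" "z \<notin> e" using x cell_eqI[of x e z] unfolding bd_cell_def by auto
    then show ?thesis using ab z by auto
  qed
  then have "{x \<in> verts X. bd_cell X x e} = {{\<phi> (-1)}, {\<phi> 1}}"
    using vert ab by auto
  then show ?thesis using that[of "{\<phi> (-1)}" "{\<phi> 1}"] \<open>\<phi> (-1) \<noteq> \<phi> 1\<close> by blast
qed

text \<open>
  The complement is the union of the closed cells that do not contain \<open>e\<close>; it is closed because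
  there are finitely many cells.
\<close>
lemma openin_star:
  assumes "e \<in> cells X"
  shows "openin (underlying X) (\<Union> {c \<in> cells X. e \<subseteq> cl c})"
proof -
  have "\<Union> {c \<in> cells X. e \<subseteq> cl c} = topspace (underlying X) - \<Union> (cl ` {d \<in> cells X. \<not> e \<subseteq> cl d})"
  proof (intro equalityI subsetI)
    fix x assume "x \<in> \<Union> {c \<in> cells X. e \<subseteq> cl c}"
    then obtain c where c: "c \<in> cells X" "e \<subseteq> cl c" "x \<in> c" by blast
    have "e \<subseteq> cl d" if "d \<in> cells X" "x \<in> cl d" for d
      using in_cl_cell[OF c(1) that(1) c(3) that(2)] bd_cell_cl c(2) by blast
    then show "x \<in> topspace (underlying X) - \<Union> (cl ` {d \<in> cells X. \<not> e \<subseteq> cl d})"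
      using c cells_cover by blast
  next
    fix x assume x: "x \<in> topspace (underlying X) - \<Union> (cl ` {d \<in> cells X. \<not> e \<subseteq> cl d})"
    then obtain c where c: "c \<in> cells X" "x \<in> c" unfolding cells_cover[symmetric] by blast
    then have "x \<in> cl c" using cell_subset_cl by blast
    then have "e \<subseteq> cl c" using x c(1) by blast
    then show "x \<in> \<Union> {c \<in> cells X. e \<subseteq> cl c}" using c by blast
  qed
  moreover have "closedin (underlying X) (\<Union> (cl ` {d \<in> cells X. \<not> e \<subseteq> cl d}))"
    using finite_cells by (intro closedin_Union) auto
  ultimately show ?thesis by (simp add: openin_diff)
qed

text \<open>
  The open star of \<open>e\<close> consists of \<open>e\<close> and the faces at \<open>e\<close>. With no face it would be an
  interval, which embeds in a line of the plane; with one face it would embed in the closed disk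
  with \<open>e\<close> on the boundary circle. Both images have points of \<open>e\<close> outside their interior, against
  invariance of domain. Among three faces, two would have equal sign at \<open>e\<close>.
\<close>
lemma edge_faces:
  assumes e: "e \<in> edges X"
  obtains f k where "f \<noteq> k" "{x \<in> faces X. bd_cell X e x} = {f, k}"
proof -
  let ?F = "{x \<in> faces X. bd_cell X e x}"
  let ?T = "underlying X"
  have ec: "e \<in> cells X" "cdim X e = 1" using e by (auto simp: edges_def)
  have "{c \<in> cells X. e \<subseteq> cl c} = insert e ?F"
  proof (intro equalityI subsetI)
    fix c assume c: "c \<in> {c \<in> cells X. e \<subseteq> cl c}"
    show "c \<in> insert e ?F"
    proof (cases "c = e")
      case False
      then have "bd_cell X e c" using c ec by (auto simp: bd_cell_def)
      then show ?thesis
        using bd_cell_cdim[of e c] cdim_le_2[of c] c ec by (auto simp: faces_def)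
    qed simp
  qed (use ec cell_subset_cl in \<open>auto simp: faces_def bd_cell_def\<close>)
  then have star: "openin ?T (\<Union> (insert e ?F))" using openin_star[OF ec(1)] by simp
  obtain x where x: "x \<in> e" using cell_nonempty ec by blast
  have inverse: "\<exists>\<psi>. continuous_map (subtopology ?T N) euclidean \<psi> \<and> inj_on \<psi> N \<and> (\<forall>y\<in>N. \<psi> y \<in> cball 0 1 \<and> \<phi> (\<psi> y) = y)"
    if \<phi>: "homeomorphic_map (top_of_set (cball (0::'b::euclidean_space) 1)) (subtopology ?T (cl c)) \<phi>"
      and N: "N \<subseteq> cl c" for c N \<phi>
  proof -
    obtain \<psi> where \<psi>: "homeomorphic_maps (top_of_set (cball (0::'b) 1)) (subtopology ?T (cl c)) \<phi> \<psi>"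
      using \<phi> homeomorphic_map_maps by blast
    have top: "topspace (subtopology ?T (cl c)) = cl c"
      by (simp add: closure_of_subset_topspace Int_absorb1)
    have "continuous_map (subtopology ?T (cl c)) (top_of_set (cball (0::'b) 1)) \<psi>"
      using \<psi> unfolding homeomorphic_maps_def by blast
    then have "continuous_map (subtopology ?T (cl c)) euclidean \<psi>" and "\<psi> \<in> cl c \<rightarrow> cball 0 1"
      unfolding continuous_map_in_subtopology top by auto
    moreover have "\<forall>y\<in>cl c. \<phi> (\<psi> y) = y" using \<psi> top unfolding homeomorphic_maps_def by auto
    ultimately show ?thesis
      using N by (intro exI[of _ \<psi>] conjI) (auto intro: continuous_map_from_subtopology_mono inj_on_inverseI[of _ \<phi>])
  qed
  have nonempty: "?F \<noteq> {}"
  proof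
    assume "?F = {}"
    then have open_e: "openin ?T e" using star unfolding \<open>?F = {}\<close> by simp
    have "disk_cell TYPE(real) ?T e" using is_cell[OF ec(1)] ec(2) by (simp add: is_cell_def)
    then obtain \<phi> where "homeomorphic_map (top_of_set (cball (0::real) 1)) (subtopology ?T (cl e)) \<phi>"
      by (rule disk_cell_param)
    from inverse[OF this cell_subset_cl[OF ec(1)]] obtain \<psi> where
      \<psi>: "continuous_map (subtopology ?T e) euclideanreal \<psi>" "inj_on \<psi> e" by blast
    \<comment> \<open>The interval is placed on a line of the plane, so that the plane version of invariance of domain applies.\<close>
    define \<psi>' :: "'a \<Rightarrow> real \<times> real" where "\<psi>' = (\<lambda>t. (t, 0)) \<circ> \<psi>"
    have "continuous_map euclideanreal euclidean (\<lambda>t. (t, 0::real))"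
      by (simp add: continuous_on_Pair)
    then have "continuous_map (subtopology ?T e) euclidean \<psi>'"
      unfolding \<psi>'_def using \<psi>(1) continuous_map_compose by blast
    moreover have "inj_on \<psi>' e" using \<psi>(2) unfolding \<psi>'_def by (auto simp: inj_on_def)
    ultimately have "\<psi>' x \<in> interior (\<psi>' ` e)"
      using surface_injection_interior[OF surface open_e x] by blast
    moreover have "\<psi>' ` e \<subseteq> {z. (0, 1) \<bullet> z = 0}" unfolding \<psi>'_def by (auto simp: inner_Pair)
    ultimately have "interior {z :: real \<times> real. (0, 1) \<bullet> z = 0} \<noteq> {}"
      using interior_mono by blast
    then show False by (simp add: interior_hyperplane zero_prod_def)
  qed
  have not_single: "?F \<noteq> {f}" for f
  proof
    assume F: "?F = {f}"
    then have f: "f \<in> cells X" "cdim X f = 2" "bd_cell X e f" by (auto simp: faces_def)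
    have open_N: "openin ?T (e \<union> f)" using star F by simp
    have "disk_cell TYPE(real \<times> real) ?T f" using is_cell[OF f(1)] f(2) by (simp add: is_cell_def)
    then obtain \<phi> where \<phi>: "homeomorphic_map (top_of_set (cball (0::real \<times> real) 1)) (subtopology ?T (cl f)) \<phi>"
      "\<phi> ` ball 0 1 = f" by (rule disk_cell_param)
    have "e \<union> f \<subseteq> cl f" using f cell_subset_cl by (auto simp: bd_cell_def)
    from inverse[OF \<phi>(1) this] obtain \<psi> where
      \<psi>: "continuous_map (subtopology ?T (e \<union> f)) euclidean \<psi>" "inj_on \<psi> (e \<union> f)"
      "\<And>y. y \<in> e \<union> f \<Longrightarrow> \<psi> y \<in> cball 0 1 \<and> \<phi> (\<psi> y) = y" by blast
    have "\<psi> x \<in> interior (\<psi> ` (e \<union> f))"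
      using surface_injection_interior[OF surface open_N _ \<psi>(1,2)] x by blast
    moreover have "\<psi> ` (e \<union> f) \<subseteq> cball 0 1" using \<psi>(3) by blast
    ultimately have "\<psi> x \<in> ball 0 1" using interior_mono interior_cball by blast
    then have "x \<in> f" using \<phi>(2) \<psi>(3)[of x] x by (metis UnI1 image_eqI)
    then show False using cell_eqI[OF ec(1) f(1) x] ec f by auto
  qed
  obtain f where f: "f \<in> ?F" using nonempty by blast
  then obtain k where k: "k \<in> ?F" "k \<noteq> f" using not_single[of f] by blast
  have "l \<in> {f, k}" if l: "l \<in> ?F" for l
  proof (rule ccontr)
    assume "l \<notin> {f, k}"
    then have "incid X e k = - incid X e f" "incid X e l = - incid X e f" "incid X e l = - incid X e k"
      using incid_faces[OF e] f k l by auto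
    then have "incid X e f = 0" by simp
    then show False using f ec by (subst (asm) incid_eq_0_iff) (auto simp: faces_def)
  qed
  then show ?thesis using that[of f k] f k by blast
qed

section \<open>Connectedness of the graph and of the dual graph\<close>

lemma cell_has_vertex:
  assumes "c \<in> cells X"
  shows "\<exists>v\<in>verts X. v \<subseteq> cl c"
proof -
  have edge: "\<exists>v\<in>verts X. v \<subseteq> cl c" if c: "c \<in> edges X" for c
  proof -
    obtain u v where "{x \<in> verts X. bd_cell X x c} = {u, v}" using edge_endpoints[OF c] .
    then have "u \<in> verts X" "bd_cell X u c" by blast+
    then show ?thesis unfolding bd_cell_def by blast
  qed
  have low: "\<exists>v\<in>verts X. v \<subseteq> cl c" if "c \<in> cells X" "cdim X c \<noteq> 2" for c
  proof (cases "cdim X c = 0")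
    case True
    then show ?thesis using that cell_subset_cl by (auto simp: verts_def)
  next
    case False
    then have "c \<in> edges X" using that cdim_le_2[of c] by (auto simp: edges_def)
    then show ?thesis by (rule edge)
  qed
  show ?thesis
  proof (cases "cdim X c = 2")
    case True
    then have "disk_cell TYPE(real \<times> real) (underlying X) c"
      using is_cell[OF assms] by (simp add: is_cell_def)
    then obtain \<phi> where "\<phi> ` sphere (0::real \<times> real) 1 = cl c - c" by (rule disk_cell_param)
    moreover have "sphere (0::real \<times> real) 1 \<noteq> {}" by simp
    ultimately obtain x where x: "x \<in> cl c" "x \<notin> c" by blast
    then obtain d where d: "d \<in> cells X" "x \<in> d" using in_cl_ex_cell by blast
    then have "bd_cell X d c" "cdim X d < 2"
      using in_cl_cell[OF d(1) assms d(2) x(1)] x True by auto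
    then show ?thesis using low[OF d(1)] bd_cell_cl[of d c] by auto
  qed (use low assms in blast)
qed

text \<open>
  In the applications \<open>S\<close> is a closed cell, the boundary circle of a face, or the whole surface,
  and \<open>y\<close> is constant along edges.
\<close>
definition monochromatic :: "('a set \<Rightarrow> 'b) \<Rightarrow> 'a set \<Rightarrow> bool" where
  "monochromatic y S \<longleftrightarrow> (\<forall>u\<in>verts X. \<forall>v\<in>verts X. u \<subseteq> S \<longrightarrow> v \<subseteq> S \<longrightarrow> y u = y v)"

text \<open>
  Two closed cells that meet share a closed cell, hence a vertex, so the labels of the closed
  cells covering \<open>S\<close> are locally constant.
\<close>
lemma monochromatic_union:
  assumes S: "connectedin (underlying X) S" and I: "I \<subseteq> cells X" "S \<subseteq> \<Union> (cl ` I)"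
    and mono: "\<And>c. c \<in> I \<Longrightarrow> monochromatic y (cl c)"
  shows "monochromatic y S"
proof -
  define l where "l c = y (SOME v. v \<in> verts X \<and> v \<subseteq> cl c)" for c
  have l: "l c = y v" if "c \<in> I" "v \<in> verts X" "v \<subseteq> cl c" for c v
  proof -
    have "(SOME v. v \<in> verts X \<and> v \<subseteq> cl c) \<in> verts X \<and> (SOME v. v \<in> verts X \<and> v \<subseteq> cl c) \<subseteq> cl c"
      using that(2,3) by (intro someI[of "\<lambda>v. v \<in> verts X \<and> v \<subseteq> cl c"]) auto
    then show ?thesis using mono[OF that(1)] that(2,3) unfolding l_def monochromatic_def by blast
  qed
  have overlap: "l c = l d" if cd: "c \<in> I" "d \<in> I" "cl c \<inter> cl d \<inter> S \<noteq> {}" for c d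
  proof -
    obtain x where x: "x \<in> cl c" "x \<in> cl d" using cd(3) by blast
    then obtain b where b: "b \<in> cells X" "x \<in> b" using in_cl_ex_cell by blast
    then have "cl b \<subseteq> cl c" "cl b \<subseteq> cl d"
      using in_cl_cell[OF b(1) _ b(2), of c] in_cl_cell[OF b(1) _ b(2), of d] x cd(1,2) I(1)
        bd_cell_cl[of b c] bd_cell_cl[of b d] by blast+
    moreover obtain v where "v \<in> verts X" "v \<subseteq> cl b" using cell_has_vertex[OF b(1)] by blast
    ultimately show ?thesis using l cd by (metis subset_trans)
  qed
  show ?thesis unfolding monochromatic_def
  proof (intro ballI impI)
    fix u v assume uv: "u \<in> verts X" "v \<in> verts X" "u \<subseteq> S" "v \<subseteq> S"
    have at: "\<exists>c\<in>I. w \<subseteq> cl c \<and> cl c \<inter> S \<noteq> {}" if "w \<in> verts X" "w \<subseteq> S" for w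
      using vert_point[OF that(1)] that(2) I(2) by blast
    obtain c d where c: "c \<in> I" "u \<subseteq> cl c" "cl c \<inter> S \<noteq> {}"
      and d: "d \<in> I" "v \<subseteq> cl d" "cl d \<inter> S \<noteq> {}"
      using at uv by meson
    have "finite I" using I(1) finite_cells finite_subset by blast
    then have "l c = l d"
      by (rule connectedin_label_unique[OF S, where C = cl]) (use I overlap c d in auto)
    then show "y u = y v" using l c d uv by metis
  qed
qed

text \<open>
  The vertices are compared first within a closed edge, then around the boundary circle of a face,
  and finally over the surface.
\<close>
lemma verts_connected:
  assumes edge: "\<And>e u v. e \<in> edges X \<Longrightarrow> u \<in> verts X \<Longrightarrow> v \<in> verts X \<Longrightarrow>
             bd_cell X u e \<Longrightarrow> bd_cell X v e \<Longrightarrow> y u = y v"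
    and "u \<in> verts X" "v \<in> verts X"
  shows "y u = y v"
proof -
  have low: "monochromatic y (cl c)" if c: "c \<in> cells X" "cdim X c \<noteq> 2" for c
  proof (cases "cdim X c = 0")
    case True
    then have "c \<in> verts X" using c by (simp add: verts_def)
    then show ?thesis
      unfolding monochromatic_def cl_vert[OF \<open>c \<in> verts X\<close>]
      using vert_point \<open>c \<in> verts X\<close> by (metis insert_not_empty subset_singletonD)
  next
    case False
    then have "c \<in> edges X" using that cdim_le_2[of c] by (auto simp: edges_def)
    moreover have "bd_cell X u c" if "u \<in> verts X" "u \<subseteq> cl c" for u
      using that c False by (auto simp: bd_cell_def verts_def)
    ultimately show ?thesis using edge unfolding monochromatic_def by blast
  qed
  have face: "monochromatic y (cl f)" if f: "f \<in> cells X" "cdim X f = 2" for f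
  proof -
    have "disk_cell TYPE(real \<times> real) (underlying X) f"
      using is_cell[OF f(1)] f(2) by (simp add: is_cell_def)
    then obtain \<phi> where \<phi>: "homeomorphic_map (top_of_set (cball (0::real \<times> real) 1)) (subtopology (underlying X) (cl f)) \<phi>"
      "\<phi> ` sphere 0 1 = cl f - f" by (rule disk_cell_param)
    have "connectedin (top_of_set (cball (0::real \<times> real) 1)) (sphere 0 1)"
      by (auto simp: connectedin_subtopology intro!: connected_sphere)
    then have "connectedin (subtopology (underlying X) (cl f)) (cl f - f)"
      using connectedin_continuous_map_image[OF homeomorphic_imp_continuous_map[OF \<phi>(1)]] \<phi>(2) by metis
    then have conn: "connectedin (underlying X) (cl f - f)" by (simp add: connectedin_subtopology)
    have "monochromatic y (cl f - f)"
    proof (rule monochromatic_union[OF conn])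
      show "{c \<in> cells X. bd_cell X c f} \<subseteq> cells X" by blast
      show "cl f - f \<subseteq> \<Union> (cl ` {c \<in> cells X. bd_cell X c f})"
      proof
        fix x assume x: "x \<in> cl f - f"
        then obtain c where c: "c \<in> cells X" "x \<in> c" using in_cl_ex_cell by blast
        then have "bd_cell X c f" using in_cl_cell[OF c(1) f(1) c(2)] x by auto
        then show "x \<in> \<Union> (cl ` {c \<in> cells X. bd_cell X c f})" using c cell_subset_cl by blast
      qed
      show "monochromatic y (cl c)" if "c \<in> {c \<in> cells X. bd_cell X c f}" for c
        using that low[of c] bd_cell_cdim[of c f] f by auto
    qed
    moreover have "u \<subseteq> cl f - f" if u: "u \<in> verts X" "u \<subseteq> cl f" for u
    proof -
      have "u \<noteq> f" "u \<in> cells X" using u f by (auto simp: verts_def)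
      then show ?thesis using cell_eqI[of u f] u f by blast
    qed
    ultimately show ?thesis unfolding monochromatic_def by blast
  qed
  have conn: "connectedin (underlying X) (topspace (underlying X))"
    using surface by (simp add: closed_surface_def connectedin_topspace)
  have "monochromatic y (topspace (underlying X))"
  proof (rule monochromatic_union[OF conn subset_refl])
    show "topspace (underlying X) \<subseteq> \<Union> (cl ` cells X)"
      unfolding cells_cover[symmetric] using cell_subset_cl by blast
    show "monochromatic y (cl c)" if "c \<in> cells X" for c
      using low[OF that] face[OF that] by blast
  qed
  moreover have "w \<subseteq> topspace (underlying X)" if "w \<in> verts X" for w
    using that cells_cover by (auto simp: verts_def)
  ultimately show ?thesis using assms(2,3) unfolding monochromatic_def by blast
qed

text \<open>
  Away from the vertices, two closed faces can only meet in an edge. The surface without its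
  vertices is connected and covered by closed faces, so labels that agree across edges are
  constant.
\<close>
lemma faces_connected:
  assumes edge: "\<And>e f k. e \<in> edges X \<Longrightarrow> f \<in> faces X \<Longrightarrow> k \<in> faces X \<Longrightarrow>
             bd_cell X e f \<Longrightarrow> bd_cell X e k \<Longrightarrow> y f = y k"
    and "f \<in> faces X" "k \<in> faces X"
  shows "y f = y k"
proof -
  let ?S = "topspace (underlying X) - \<Union> (verts X)"
  have "finite (\<Union> (verts X))"
    using finite_verts vert_point by (intro finite_Union) auto
  then have conn: "connectedin (underlying X) ?S"
    by (rule connectedin_surface_minus_finite[OF surface])
  have meets: "cl f \<inter> ?S \<noteq> {}" if f: "f \<in> faces X" for f
  proof -
    have fc: "f \<in> cells X" using f by (simp add: faces_def)
    obtain x where "x \<in> f" using cell_nonempty[OF fc] by blast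
    moreover have "x \<notin> v" if "v \<in> verts X" for v
      using cell_eqI[of v f x] that f \<open>x \<in> f\<close> by (auto simp: verts_def faces_def)
    moreover have "x \<in> topspace (underlying X)" "x \<in> cl f"
      using \<open>x \<in> f\<close> cells_cover cell_subset_cl[OF fc] fc by blast+
    ultimately show ?thesis by blast
  qed
  show ?thesis
  proof (rule connectedin_label_unique[OF conn finite_faces, of cl])
    show "?S \<subseteq> \<Union> (cl ` faces X)"
    proof
      fix x assume x: "x \<in> ?S"
      then obtain c where c: "c \<in> cells X" "x \<in> c" using cells_cover by blast
      then have "c \<notin> verts X" using x by blast
      then have "c \<in> edges X \<or> c \<in> faces X"
        using c cdim_le_2[of c] by (auto simp: verts_def edges_def faces_def)
      then show "x \<in> \<Union> (cl ` faces X)"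
      proof
        assume "c \<in> edges X"
        then obtain f k where "{x \<in> faces X. bd_cell X c x} = {f, k}" by (rule edge_faces)
        then have "f \<in> faces X" "bd_cell X c f" by blast+
        then show ?thesis using c(2) unfolding bd_cell_def by blast
      next
        assume "c \<in> faces X"
        then show ?thesis using c cell_subset_cl by blast
      qed
    qed
    show "y f = y k" if fk: "f \<in> faces X" "k \<in> faces X" "cl f \<inter> cl k \<inter> ?S \<noteq> {}" for f k
    proof -
      obtain x where x: "x \<in> cl f" "x \<in> cl k" "x \<in> ?S" using fk(3) by blast
      then obtain c where c: "c \<in> cells X" "x \<in> c" using in_cl_ex_cell by blast
      then have "c \<notin> verts X" using x by blast
      have fk': "f \<in> cells X" "cdim X f = 2" "k \<in> cells X" "cdim X k = 2"
        using fk by (auto simp: faces_def)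
      then have "c = f \<or> bd_cell X c f \<and> cdim X c < 2" "c = k \<or> bd_cell X c k \<and> cdim X c < 2"
        using in_cl_cell[OF c(1) fk'(1) c(2) x(1)] in_cl_cell[OF c(1) fk'(3) c(2) x(2)] by auto
      moreover have "c \<in> edges X" if "cdim X c < 2"
        using that c \<open>c \<notin> verts X\<close> by (auto simp: verts_def edges_def)
      ultimately show ?thesis using edge[of c f k] fk fk' by auto
    qed
  qed (use assms meets in auto)
qed

end

section \<open>The first homology of the surface\<close>

definition chains_on :: "'c set \<Rightarrow> ('c \<Rightarrow>\<^sub>0 real) set" where
  "chains_on A = {x. Poly_Mapping.keys x \<subseteq> A}"

lemma lookup_scaleR [simp]: "Poly_Mapping.lookup (r *\<^sub>R x) i = r * Poly_Mapping.lookup x i"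
  for x :: "'c \<Rightarrow>\<^sub>0 real"
proof -
  have "finite {i. r *\<^sub>R Poly_Mapping.lookup x i \<noteq> 0}"
    by (rule finite_subset[OF _ finite_lookup[of x]]) auto
  then show ?thesis by (simp add: scaleR_poly_mapping_def)
qed

lemma chains_iff: "x \<in> chains_on A \<longleftrightarrow> (\<forall>c. c \<notin> A \<longrightarrow> Poly_Mapping.lookup x c = 0)"
  by (auto simp: chains_on_def subset_iff in_keys_iff)

lemma subspace_chains: "subspace (chains_on A)"
  by (auto simp: subspace_def chains_iff lookup_add)

lemma chain_eq_sum:
  assumes "finite A" "x \<in> chains_on A"
  shows "x = (\<Sum>a\<in>A. Poly_Mapping.lookup x a *\<^sub>R Poly_Mapping.single a 1)"
proof (rule poly_mapping_eqI)
  fix k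
  have "(\<Sum>a\<in>A. Poly_Mapping.lookup x a * (1 when a = k)) = (\<Sum>a\<in>A. if a = k then Poly_Mapping.lookup x a else 0)"
    by (rule sum.cong) (auto simp: when_def)
  then show "Poly_Mapping.lookup x k = Poly_Mapping.lookup (\<Sum>a\<in>A. Poly_Mapping.lookup x a *\<^sub>R Poly_Mapping.single a 1) k"
    using assms by (simp add: lookup_sum lookup_single chains_iff)
qed

lemma chains_span:
  assumes "finite A"
  shows "chains_on A = span ((\<lambda>a. Poly_Mapping.single a (1::real)) ` A)"
proof (rule antisym)
  show "chains_on A \<subseteq> span ((\<lambda>a. Poly_Mapping.single a (1::real)) ` A)"
  proof
    fix x :: "'a \<Rightarrow>\<^sub>0 real" assume "x \<in> chains_on A"
    then show "x \<in> span ((\<lambda>a. Poly_Mapping.single a (1::real)) ` A)"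
      by (subst chain_eq_sum[OF assms]) (auto intro: span_sum span_scale span_base)
  qed
  show "span ((\<lambda>a. Poly_Mapping.single a (1::real)) ` A) \<subseteq> chains_on A"
    by (rule span_minimal[OF _ subspace_chains]) (auto simp: chains_iff lookup_single when_def)
qed

lemma dim_chains:
  assumes "finite A"
  shows "dim (chains_on A) = card A"
proof -
  let ?s = "\<lambda>a. Poly_Mapping.single a (1::real)"
  have inj: "inj_on ?s A"
    by (rule inj_onI) (metis lookup_single_eq lookup_single_not_eq zero_neq_one)
  have "independent (?s ` A)"
  proof (rule real_vector.independent_if_scalars_zero)
    fix c x assume *: "(\<Sum>x\<in>?s ` A. c x *\<^sub>R x) = 0" "x \<in> ?s ` A"
    then obtain k where k: "k \<in> A" "x = ?s k" by blast
    have "0 = Poly_Mapping.lookup (\<Sum>a\<in>A. c (?s a) *\<^sub>R ?s a) k"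
      using *(1) by (simp add: sum.reindex[OF inj])
    also have "\<dots> = (\<Sum>a\<in>A. if a = k then c (?s a) else 0)"
      by (auto simp: lookup_sum lookup_single when_def intro: sum.cong)
    also have "\<dots> = c (?s k)" using assms k by simp
    finally show "c x = 0" using k by simp
  qed (use assms in simp)
  then have "dim (chains_on A) = card (?s ` A)"
    unfolding chains_span[OF assms] by (rule dim_span_eq_card_independent)
  then show ?thesis using inj by (simp add: card_image)
qed

text \<open>
  Both boundary maps, from faces to edges and from edges to vertices, are instances of this one
  operator, because incidence numbers vanish unless the dimensions differ by one.
\<close>
definition boundary ::
    "('a, 'm) cell_complex_scheme \<Rightarrow> ('a set \<Rightarrow>\<^sub>0 real) \<Rightarrow> ('a set \<Rightarrow>\<^sub>0 real)" where
  "boundary X x =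
     (\<Sum>c\<in>cells X. Poly_Mapping.single c (\<Sum>d\<in>cells X. of_int (incid X c d) * Poly_Mapping.lookup x d))"

context surface_decomposition
begin

lemma lookup_boundary:
  "Poly_Mapping.lookup (boundary X x) c =
     (if c \<in> cells X then \<Sum>d\<in>cells X. of_int (incid X c d) * Poly_Mapping.lookup x d else 0)"
proof -
  have "Poly_Mapping.lookup (boundary X x) c =
     (\<Sum>b\<in>cells X. if b = c then \<Sum>d\<in>cells X. of_int (incid X b d) * Poly_Mapping.lookup x d else 0)"
    by (auto simp: boundary_def lookup_sum lookup_single when_def intro!: sum.cong)
  then show ?thesis using finite_cells by simp
qed

lemma linear_boundary: "linear (boundary X)"
  by (rule linearI; rule poly_mapping_eqI)
    (simp_all add: lookup_boundary lookup_add sum.distrib sum_distrib_left algebra_simps)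

lemma lookup_boundary_edge:
  assumes "e \<in> edges X" "x \<in> chains_on (faces X)"
  shows "Poly_Mapping.lookup (boundary X x) e =
    (\<Sum>f | f \<in> faces X \<and> bd_cell X e f. of_int (incid X e f) * Poly_Mapping.lookup x f)"
proof -
  have "(\<Sum>f | f \<in> faces X \<and> bd_cell X e f. of_int (incid X e f) * Poly_Mapping.lookup x f)
     = (\<Sum>d\<in>cells X. of_int (incid X e d) * Poly_Mapping.lookup x d)"
    using assms finite_cells
    by (intro sum.mono_neutral_left) (auto simp: faces_def edges_def chains_iff incid_eq_0_iff)
  then show ?thesis using assms by (simp add: lookup_boundary edges_def)
qed

lemma lookup_boundary_vert:
  assumes "v \<in> verts X" "x \<in> chains_on (edges X)"
  shows "Poly_Mapping.lookup (boundary X x) v =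
    (\<Sum>e | e \<in> edges X \<and> bd_cell X v e. of_int (incid X v e) * Poly_Mapping.lookup x e)"
proof -
  have "(\<Sum>e | e \<in> edges X \<and> bd_cell X v e. of_int (incid X v e) * Poly_Mapping.lookup x e)
     = (\<Sum>d\<in>cells X. of_int (incid X v d) * Poly_Mapping.lookup x d)"
    using assms finite_cells
    by (intro sum.mono_neutral_left) (auto simp: verts_def edges_def chains_iff incid_eq_0_iff)
  then show ?thesis using assms by (simp add: lookup_boundary verts_def)
qed

lemma boundary_edges: "x \<in> chains_on (edges X) \<Longrightarrow> boundary X x \<in> chains_on (verts X)"
  by (auto simp: chains_iff lookup_boundary verts_def edges_def incid_eq_0_iff intro!: sum.neutral)

lemma boundary_faces: "x \<in> chains_on (faces X) \<Longrightarrow> boundary X x \<in> chains_on (edges X)"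
  by (auto simp: chains_iff lookup_boundary faces_def edges_def incid_eq_0_iff intro!: sum.neutral)

lemma incid_incid:
  assumes "b \<in> cells X" "d \<in> cells X"
  shows "(\<Sum>c\<in>cells X. incid X b c * incid X c d) = 0"
proof (cases "bd_cell X b d")
  case True
  then show ?thesis
    using decomposition by (auto simp: oriented_surface_decomposition_def signed_incidence_def)
next
  case False
  then show ?thesis
    using assms bd_cell_trans by (intro sum.neutral) (auto simp: incid_eq_0_iff)
qed

lemma boundary_boundary: "boundary X (boundary X x) = 0"
proof (rule poly_mapping_eqI)
  fix b
  show "Poly_Mapping.lookup (boundary X (boundary X x)) b = Poly_Mapping.lookup 0 b"
  proof (cases "b \<in> cells X")
    case True
    have "Poly_Mapping.lookup (boundary X (boundary X x)) b =
      (\<Sum>c\<in>cells X. \<Sum>d\<in>cells X. of_int (incid X b c * incid X c d) * Poly_Mapping.lookup x d)"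
      using True by (simp add: lookup_boundary sum_distrib_left mult.assoc)
    also have "\<dots> = (\<Sum>d\<in>cells X. of_int (\<Sum>c\<in>cells X. incid X b c * incid X c d) * Poly_Mapping.lookup x d)"
      by (subst sum.swap) (simp add: sum_distrib_right)
    also have "\<dots> = 0" using True by (simp add: incid_incid)
    finally show ?thesis by simp
  qed (simp add: lookup_boundary)
qed

lemma incid_ends:
  assumes "e \<in> edges X" "u \<in> verts X" "v \<in> verts X" "u \<noteq> v" "bd_cell X u e" "bd_cell X v e"
  shows "incid X v e = - incid X u e" "incid X u e = 1 \<or> incid X u e = -1"
proof -
  have "incid X u e * incid X v e = -1"
    using decomposition assms unfolding oriented_surface_decomposition_def signed_incidence_def
    by blast
  then show "incid X u e = 1 \<or> incid X u e = -1"
    using pos_zmult_eq_1_iff_lemma[of "incid X u e" "- incid X v e"] by auto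
  with \<open>_ = -1\<close> show "incid X v e = - incid X u e" by auto
qed

lemma edge_ends_eq:
  assumes e: "e \<in> edges X" "u \<in> verts X" "v \<in> verts X" "u \<noteq> v" "bd_cell X u e" "bd_cell X v e"
  shows "{x \<in> verts X. bd_cell X x e} = {u, v}"
proof -
  obtain u' v' where "{x \<in> verts X. bd_cell X x e} = {u', v'}"
    using edge_endpoints[OF e(1)] .
  moreover from this have "u \<in> {u', v'}" "v \<in> {u', v'}" using e by blast+
  ultimately show ?thesis using e(4) by auto
qed

lemma edge_faces_eq:
  assumes e: "e \<in> edges X" "f \<in> faces X" "k \<in> faces X" "f \<noteq> k" "bd_cell X e f" "bd_cell X e k"
  shows "{x \<in> faces X. bd_cell X e x} = {f, k}"
proof -
  obtain f' k' where "{x \<in> faces X. bd_cell X e x} = {f', k'}"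
    using edge_faces[OF e(1)] .
  moreover from this have "f \<in> {f', k'}" "k \<in> {f', k'}" using e by blast+
  ultimately show ?thesis using e(4) by auto
qed

lemma boundary_edge_difference:
  assumes e: "e \<in> edges X" "f \<in> faces X" "k \<in> faces X" "f \<noteq> k" "bd_cell X e f" "bd_cell X e k"
    and x: "x \<in> chains_on (faces X)"
  shows "Poly_Mapping.lookup (boundary X x) e =
    of_int (incid X e f) * (Poly_Mapping.lookup x f - Poly_Mapping.lookup x k)"
  using e x incid_faces[OF e] by (simp add: lookup_boundary_edge edge_faces_eq[OF e] algebra_simps)

lemma boundary_single_edge:
  assumes e: "e \<in> edges X" "u \<in> verts X" "v \<in> verts X" "u \<noteq> v" "bd_cell X u e" "bd_cell X v e"
  shows "boundary X (of_int (incid X u e) *\<^sub>R Poly_Mapping.single e 1)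
     = Poly_Mapping.single u 1 - Poly_Mapping.single v 1"
proof (rule poly_mapping_eqI)
  fix c
  have ends: "{x \<in> verts X. bd_cell X x e} = {u, v}" by (rule edge_ends_eq[OF e])
  have "Poly_Mapping.lookup (boundary X (Poly_Mapping.single e 1)) c
     = (if c \<in> cells X then of_int (incid X c e) else 0)"
  proof -
    have "(\<Sum>d\<in>cells X. of_int (incid X c d) * (1 when e = d)) = 
      (\<Sum>d\<in>cells X. if d = e then of_int (incid X c d) else (0::real))"
      by (auto simp: when_def intro!: sum.cong)
    then show ?thesis using e(1) finite_cells by (simp add: lookup_boundary lookup_single edges_def)
  qed
  also have "\<dots> = of_int (incid X u e) * ((1 when u = c) - (1 when v = c))"
  proof -
    consider "c = u" | "c = v" | "c \<noteq> u" "c \<noteq> v" by blast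
    then show ?thesis
    proof cases
      case 3
      then have "incid X c e = 0" if "c \<in> cells X"
        using that ends e(1) by (subst incid_eq_0_iff) (auto simp: edges_def verts_def)
      then show ?thesis using 3 by simp
    qed (use e incid_ends[OF e] in \<open>auto simp: verts_def\<close>)
  qed
  finally show "Poly_Mapping.lookup (boundary X (of_int (incid X u e) *\<^sub>R Poly_Mapping.single e 1)) c
     = Poly_Mapping.lookup (Poly_Mapping.single u 1 - Poly_Mapping.single v 1) c"
    using incid_ends(2)[OF e]
    by (auto simp: linear_scale[OF linear_boundary] lookup_minus lookup_single)
qed

text \<open>
  By connectedness, the differences of vertices are boundaries of edge chains, so the boundaries
  have codimension at most one among the vertex chains. Rank-nullity then bounds the cycles.
\<close>
lemma dim_cycles: "dim {x \<in> chains_on (edges X). boundary X x = 0} + card (verts X) \<le> card (edges X) + 1"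
proof -
  let ?s = "\<lambda>a. Poly_Mapping.single a (1::real)"
  let ?im = "boundary X ` chains_on (edges X)"
  have im: "subspace ?im"
    by (rule linear_subspace_image[OF linear_boundary subspace_chains])
  have "card (verts X) \<le> dim ?im + 1"
  proof (cases "verts X = {}")
    case False
    then obtain v0 where v0: "v0 \<in> verts X" by blast
    have conn: "?s u - ?s v \<in> ?im" if "u \<in> verts X" "v \<in> verts X" for u v
    proof -
      \<comment> \<open>Being homologous to \<open>v0\<close> is a labelling of the vertices that is constant along edges.\<close>
      have "(?s u - ?s v0 \<in> ?im) = (?s v - ?s v0 \<in> ?im)" if "u \<in> verts X" "v \<in> verts X" for u v
        using _ that
      proof (rule verts_connected)
        fix e u v assume e: "e \<in> edges X" "u \<in> verts X" "v \<in> verts X" "bd_cell X u e" "bd_cell X v e"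
        show "(?s u - ?s v0 \<in> ?im) = (?s v - ?s v0 \<in> ?im)"
        proof (cases "u = v")
          case False
          have "of_int (incid X u e) *\<^sub>R ?s e \<in> chains_on (edges X)"
            using e(1) by (auto simp: chains_iff lookup_single)
          then have *: "?s u - ?s v \<in> ?im"
            using boundary_single_edge[OF e(1-3) False e(4,5)] by (metis image_eqI)
          show ?thesis
          proof
            assume "?s u - ?s v0 \<in> ?im"
            from subspace_diff[OF im this *] show "?s v - ?s v0 \<in> ?im" by simp
          next
            assume "?s v - ?s v0 \<in> ?im"
            from subspace_add[OF im this *] show "?s u - ?s v0 \<in> ?im" by simp
          qed
        qed simp
      qed
      from this[OF that(1) v0] this[OF that(2) v0] subspace_0[OF im]
      have "?s u - ?s v0 \<in> ?im" "?s v - ?s v0 \<in> ?im" by auto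
      from subspace_diff[OF im this] show ?thesis by simp
    qed
    obtain C where C: "C \<subseteq> ?im" "independent C" "?im \<subseteq> span C" "card C = dim ?im"
      using basis_exists by blast
    have im_verts: "?im \<subseteq> chains_on (verts X)" using boundary_edges by blast
    have "finite C"
      using independent_span_bound[OF _ C(2)] C(1) im_verts chains_span[OF finite_verts] finite_verts
      by (metis finite_imageI subset_trans)
    have "chains_on (verts X) \<subseteq> span (insert (?s v0) C)"
      unfolding chains_span[OF finite_verts]
    proof (rule span_minimal[OF _ subspace_span], rule image_subsetI)
      fix v assume v: "v \<in> verts X"
      have "?s v - 1 *\<^sub>R ?s v0 \<in> span C" using conn[OF v v0] C(3) by auto
      then show "?s v \<in> span (insert (?s v0) C)" unfolding span_breakdown_eq by blast
    qed
    then have "card (verts X) \<le> card (insert (?s v0) C)"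
      using dim_le_card[of "chains_on (verts X)"] \<open>finite C\<close> by (simp add: dim_chains[OF finite_verts])
    also have "\<dots> \<le> dim ?im + 1" using C(4) \<open>finite C\<close> by (simp add: card_insert_if)
    finally show ?thesis .
  qed simp
  moreover have "card (edges X) = dim {x \<in> chains_on (edges X). boundary X x = 0} + dim ?im"
    using rank_nullity[OF _ _ subspace_chains linear_boundary, of "?s ` edges X" "edges X"]
      finite_edges by (simp add: chains_span[symmetric] dim_chains)
  ultimately show ?thesis by simp
qed

lemma boundary_faces_eq_0:
  assumes "x \<in> chains_on (faces X)" "boundary X x = 0" "f \<in> faces X" "k \<in> faces X"
  shows "Poly_Mapping.lookup x f = Poly_Mapping.lookup x k"
  using _ assms(3,4)
proof (rule faces_connected)
  fix e f k assume e: "e \<in> edges X" "f \<in> faces X" "k \<in> faces X" "bd_cell X e f" "bd_cell X e k"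
  show "Poly_Mapping.lookup x f = Poly_Mapping.lookup x k"
  proof (cases "f = k")
    case False
    have "of_int (incid X e f) * (Poly_Mapping.lookup x f - Poly_Mapping.lookup x k) = 0"
      using boundary_edge_difference[OF e(1-3) False e(4,5) assms(1)] assms(2) by simp
    moreover have "incid X e f \<noteq> 0" 
      using e by (subst incid_eq_0_iff) (auto simp: edges_def faces_def)
    ultimately show ?thesis by simp
  qed simp
qed

text \<open>
  A chain of faces with zero boundary takes equal values on adjacent faces, so it is a multiple
  of the fundamental cycle.
\<close>
lemma dim_boundaries: "card (faces X) \<le> dim (boundary X ` chains_on (faces X)) + 1"
proof -
  let ?s = "\<lambda>a. Poly_Mapping.single a (1::real)"
  let ?K = "{x \<in> chains_on (faces X). boundary X x = 0}"
  let ?t = "\<Sum>f\<in>faces X. ?s f"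
  have "?K \<subseteq> span {?t}"
  proof
    fix x assume x: "x \<in> ?K"
    obtain c where c: "\<And>f. f \<in> faces X \<Longrightarrow> Poly_Mapping.lookup x f = c"
      using boundary_faces_eq_0[of x] x by (cases "faces X = {}") blast+
    have "x = (\<Sum>f\<in>faces X. Poly_Mapping.lookup x f *\<^sub>R ?s f)"
      using x by (intro chain_eq_sum finite_faces) auto
    also have "\<dots> = c *\<^sub>R ?t" using c by (simp add: scaleR_sum_right)
    finally show "x \<in> span {?t}" by (metis insertI1 span_base span_scale)
  qed
  then have "dim ?K \<le> 1" using dim_le_card[of ?K "{?t}"] by simp
  moreover have "card (faces X) = dim ?K + dim (boundary X ` chains_on (faces X))"
    using rank_nullity[OF _ _ subspace_chains linear_boundary, of "?s ` faces X" "faces X"]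
      finite_faces by (simp add: chains_span[symmetric] dim_chains)
  ultimately show ?thesis by simp
qed

text \<open>
  This is the bound \<open>dim H\<^sub>1 \<le> 2g\<close>, with \<open>H\<^sub>1\<close> represented by a complement of the boundaries in
  the cycles. It follows from \<open>E - V + 1 - (F - 1) = 2g\<close>.
\<close>
lemma homology_generators:
  obtains T where "finite T" "card T \<le> 2 * g"
    "{x \<in> chains_on (edges X). boundary X x = 0} \<subseteq> span (boundary X ` chains_on (faces X) \<union> T)"
proof -
  let ?Z = "{x \<in> chains_on (edges X). boundary X x = 0}" and ?B = "boundary X ` chains_on (faces X)"
  have BZ: "?B \<subseteq> ?Z" using boundary_faces boundary_boundary by auto
  obtain C where C: "C \<subseteq> ?B" "independent C" "?B \<subseteq> span C" "card C = dim ?B"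
    using basis_exists by blast
  obtain D where D: "C \<subseteq> D" "D \<subseteq> ?Z" "independent D" "?Z \<subseteq> span D"
    using maximal_independent_subset_extend[OF _ C(2), of ?Z] C(1) BZ by blast
  have "finite D"
    using independent_span_bound[OF _ D(3)] D(2) chains_span[OF finite_edges] finite_edges
    by (metis (no_types, lifting) finite_imageI mem_Collect_eq subsetI subset_iff)
  have "card D = dim ?Z" using D basis_card_eq_dim by metis
  show ?thesis
  proof (rule that[of "D - C"])
    show "finite (D - C)" using \<open>finite D\<close> by simp
    have "card (D - C) = card D - card C"
      using D(1) \<open>finite D\<close> by (meson card_Diff_subset finite_subset)
    moreover have "int (card (verts X)) - int (card (edges X)) + int (card (faces X)) = 2 - 2 * int g"
      using decomposition by (simp add: oriented_surface_decomposition_def euler_char_def)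
    ultimately show "card (D - C) \<le> 2 * g"
      using dim_cycles dim_boundaries C(4) \<open>card D = _\<close> by linarith
    have "D \<subseteq> ?B \<union> (D - C)" using C(1) by blast
    then show "?Z \<subseteq> span (?B \<union> (D - C))"
      using D(4) span_mono by blast
  qed
qed

end

section \<open>From self stresses to liftings\<close>

text \<open>
  The three obstruction chains of a stress \<open>w\<close> are all of the form \<open>e \<mapsto> m\<^sub>e w\<^sub>e\<close>.
\<close>
definition weighted :: "('c \<Rightarrow> real) \<Rightarrow> ('c \<Rightarrow>\<^sub>0 real) \<Rightarrow> ('c \<Rightarrow>\<^sub>0 real)" where
  "weighted m w = Abs_poly_mapping (\<lambda>c. m c * Poly_Mapping.lookup w c)"

lemma lookup_weighted [simp]: "Poly_Mapping.lookup (weighted m w) c = m c * Poly_Mapping.lookup w c"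
proof -
  have "finite {c. m c * Poly_Mapping.lookup w c \<noteq> 0}"
    by (rule finite_subset[OF _ finite_lookup[of w]]) auto
  then show ?thesis by (simp add: weighted_def)
qed

lemma linear_weighted: "linear (weighted m)"
  by (rule linearI; rule poly_mapping_eqI) (simp_all add: lookup_add algebra_simps)

lemma weighted_chains: "w \<in> chains_on A \<Longrightarrow> weighted m w \<in> chains_on A"
  by (simp add: chains_iff)

lemma linear_quarter_turn: "linear quarter_turn"
  by (rule linearI) (simp_all add: quarter_turn_def)

lemma inner_quarter_turn_self: "quarter_turn z \<bullet> z = 0"
  by (cases z) (simp add: quarter_turn_def inner_Pair)

lemma quarter_turn_eq_0: "quarter_turn z = 0 \<longleftrightarrow> z = 0"
  by (cases z) (auto simp: quarter_turn_def zero_prod_def)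

lemma gradient_affine: "gradient (\<lambda>x. a \<bullet> x + b) x = a"
proof -
  have *: "GDERIV (\<lambda>x. a \<bullet> x + b) x :> a"
    unfolding gderiv_def by (auto intro!: derivative_eq_intros simp: inner_commute)
  have "D = a" if "GDERIV (\<lambda>x. a \<bullet> x + b) x :> D" for D
  proof -
    have "(\<lambda>h. h \<bullet> D) = (\<lambda>h. h \<bullet> a)"
      using has_derivative_unique that * unfolding gderiv_def by blast
    then have "(D - a) \<bullet> D = (D - a) \<bullet> a" by meson
    then have "(D - a) \<bullet> (D - a) = 0" by (simp add: inner_diff_right)
    then show "D = a" by simp
  qed
  with * show ?thesis unfolding gradient_def by blast
qed

context surface_decomposition
begin

lemma self_stresses_iff:
  "w \<in> self_stresses X p \<longleftrightarrow> w \<in> chains_on (edges X) \<and>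
     (\<forall>v\<in>verts X. (\<Sum>e | e \<in> edges X \<and> bd_cell X v e.
        (of_int (incid X v e) * Poly_Mapping.lookup w e) *\<^sub>R edge_dir X p e) = 0)"
  by (simp add: self_stresses_def chains_on_def)

lemma subspace_self_stresses: "subspace (self_stresses X p)"
  unfolding subspace_def
  by (auto simp: self_stresses_iff subspace_0 subspace_add subspace_scale subspace_chains lookup_add
      distrib_left scaleR_add_left sum.distrib mult.left_commute scaleR_scaleR[symmetric]
      scaleR_sum_right[symmetric] simp del: scaleR_scaleR)

lemma edge_dir_ends:
  assumes e: "e \<in> edges X" "u \<in> verts X" "v \<in> verts X" "u \<noteq> v" "bd_cell X u e" "bd_cell X v e"
  shows "edge_dir X p e = sgn (of_int (incid X u e) *\<^sub>R (p u - p v))"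
  using incid_ends(1)[OF e] e(4) 
  by (simp add: edge_dir_def edge_ends_eq[OF e] scaleR_diff_right)

lemma edge_dir_nonzero:
  assumes "diagram X p" and e: "e \<in> edges X"
  shows "edge_dir X p e \<noteq> 0"
proof -
  obtain u v where uv: "u \<noteq> v" "{x \<in> verts X. bd_cell X x e} = {u, v}"
    using edge_endpoints[OF e] .
  then have ends: "u \<in> verts X" "v \<in> verts X" "bd_cell X u e" "bd_cell X v e" by blast+
  then have "p u \<noteq> p v" using assms(1) uv(1) by (auto simp: diagram_def inj_on_def)
  then show ?thesis
    using edge_dir_ends[OF e ends(1,2) uv(1) ends(3,4)] incid_ends(2)[OF e ends(1,2) uv(1) ends(3,4)]
    by (auto simp: sgn_zero_iff)
qed

text \<open>
  The difference of the ends is parallel to \<open>\<tau>\<^sub>e\<close>, hence orthogonal to \<open>J\<tau>\<^sub>e\<close>.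
\<close>
lemma normal_ends:
  assumes e: "e \<in> edges X" "u \<in> verts X" "v \<in> verts X" "bd_cell X u e" "bd_cell X v e"
  shows "quarter_turn (edge_dir X p e) \<bullet> p u = quarter_turn (edge_dir X p e) \<bullet> p v"
proof (cases "u = v")
  case False
  let ?z = "of_int (incid X u e) *\<^sub>R (p u - p v)"
  have t: "edge_dir X p e = sgn ?z" by (rule edge_dir_ends[OF e(1-3) False e(4,5)])
  have "z = norm z *\<^sub>R sgn z" for z :: "real \<times> real"
    by (cases "z = 0") (simp_all add: sgn_div_norm)
  then have z: "?z = norm ?z *\<^sub>R sgn ?z" .
  have "quarter_turn (sgn ?z) \<bullet> ?z = norm ?z * (quarter_turn (sgn ?z) \<bullet> sgn ?z)"
    by (subst (2) z) (simp only: inner_scaleR_right)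
  then have "quarter_turn (sgn ?z) \<bullet> ?z = 0" by (simp only: inner_quarter_turn_self mult_zero_right)
  then have "of_int (incid X u e) * (quarter_turn (sgn ?z) \<bullet> (p u - p v)) = 0"
    by (simp only: inner_scaleR_right)
  then have "quarter_turn (edge_dir X p e) \<bullet> (p u - p v) = 0"
    unfolding t using incid_ends(2)[OF e(1-3) False e(4,5)] by auto
  then show ?thesis by (simp add: inner_diff_right)
qed simp

text \<open>
  The factor \<open>m\<^sub>e\<close> may depend on the chosen edge only through a linear functional of \<open>\<tau>\<^sub>e\<close> at each
  vertex, so equilibrium of forces at the vertex carries over to the weighted chain. The
  functional is allowed to vary with the vertex: for the constant terms of the lifting it is
  \<open>\<lambda>z. - Jz \<bullet> p\<^sub>v\<close>.
\<close>
lemma weighted_stress_cycle: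
  assumes w: "w \<in> self_stresses X p"
    and m: "\<And>v. v \<in> verts X \<Longrightarrow>
      \<exists>L. linear L \<and> (\<forall>e\<in>edges X. bd_cell X v e \<longrightarrow> m e = L (edge_dir X p e))"
  shows "boundary X (weighted m w) = 0"
proof (rule poly_mapping_eqI)
  fix v
  have wE: "weighted m w \<in> chains_on (edges X)"
    using w by (simp add: self_stresses_iff weighted_chains)
  show "Poly_Mapping.lookup (boundary X (weighted m w)) v = Poly_Mapping.lookup 0 v"
  proof (cases "v \<in> verts X")
    case True
    then obtain L where L: "linear L" "\<And>e. e \<in> edges X \<Longrightarrow> bd_cell X v e \<Longrightarrow> m e = L (edge_dir X p e)"
      using m by blast
    have "Poly_Mapping.lookup (boundary X (weighted m w)) v =
      (\<Sum>e | e \<in> edges X \<and> bd_cell X v e. of_int (incid X v e) * (m e * Poly_Mapping.lookup w e))"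
      using lookup_boundary_vert[OF True wE] by simp
    also have "\<dots> = (\<Sum>e | e \<in> edges X \<and> bd_cell X v e.
        L ((of_int (incid X v e) * Poly_Mapping.lookup w e) *\<^sub>R edge_dir X p e))"
      using L by (intro sum.cong) (auto simp: linear_scale)
    also have "\<dots> = L (\<Sum>e | e \<in> edges X \<and> bd_cell X v e.
        (of_int (incid X v e) * Poly_Mapping.lookup w e) *\<^sub>R edge_dir X p e)"
      by (simp add: linear_sum[OF L(1)])
    also have "\<dots> = 0" using w True L(1) by (simp add: self_stresses_iff linear_0)
    finally show ?thesis by simp
  next
    case False
    then show ?thesis using boundary_edges[OF wE] by (simp add: chains_iff)
  qed
qed

text \<open>
  Requiring the homology class of the weighted chain to vanish costs at most \<open>2g\<close> dimensions.
\<close>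
lemma dim_weighted_boundaries:
  assumes S: "subspace S" "S \<subseteq> self_stresses X p"
    and m: "\<And>v. v \<in> verts X \<Longrightarrow>
      \<exists>L. linear L \<and> (\<forall>e\<in>edges X. bd_cell X v e \<longrightarrow> m e = L (edge_dir X p e))"
  defines "S' \<equiv> {w \<in> S. weighted m w \<in> boundary X ` chains_on (faces X)}"
  shows "subspace S'" "dim S \<le> dim S' + 2 * g"
proof -
  let ?B = "boundary X ` chains_on (faces X)"
  have B: "subspace ?B" by (rule linear_subspace_image[OF linear_boundary subspace_chains])
  then have spanB: "span ?B = ?B" by (simp add: span_eq_iff)
  show "subspace S'"
    using S(1) B unfolding S'_def subspace_def
    by (auto simp: linear_0[OF linear_weighted] linear_add[OF linear_weighted]
        linear_scale[OF linear_weighted])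
  obtain T where T: "finite T" "card T \<le> 2 * g"
    "{x \<in> chains_on (edges X). boundary X x = 0} \<subseteq> span (?B \<union> T)"
    by (rule homology_generators)
  have "weighted m ` S \<subseteq> span (?B \<union> T)"
  proof (rule subset_trans[OF _ T(3)], rule image_subsetI)
    fix w assume "w \<in> S"
    then have "w \<in> self_stresses X p" using S(2) by blast
    then show "weighted m w \<in> {x \<in> chains_on (edges X). boundary X x = 0}"
      using weighted_stress_cycle[OF _ m] by (simp add: weighted_chains self_stresses_iff)
  qed
  moreover have "S \<subseteq> span ((\<lambda>a. Poly_Mapping.single a 1) ` edges X)"
    using S(2) unfolding chains_span[OF finite_edges, symmetric] by (auto simp: self_stresses_iff)
  ultimately have "dim S \<le> dim {w \<in> S. weighted m w \<in> span ?B} + card T"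
    using finite_edges T(1) S(1) by (intro dim_preimage_ge[OF _ _ _ linear_weighted]) auto
  then show "dim S \<le> dim S' + 2 * g" unfolding S'_def spanB using T(2) by linarith
qed

text \<open>
  The chains \<open>a\<close> and \<open>b\<close> are the two coordinates of the slopes of a lifting, and \<open>c\<close> holds its
  constant terms. Imposing the three vanishing conditions in turn costs at most \<open>6g\<close>
  dimensions.
\<close>
lemma bounding_stress:
  assumes "dim (self_stresses X p) > 6 * g"
  obtains w a b c where "w \<in> self_stresses X p" "w \<noteq> 0"
    "a \<in> chains_on (faces X)" "b \<in> chains_on (faces X)" "c \<in> chains_on (faces X)"
    "\<And>e. e \<in> edges X \<Longrightarrow> 
       (Poly_Mapping.lookup (boundary X a) e, Poly_Mapping.lookup (boundary X b) e)
       = Poly_Mapping.lookup w e *\<^sub>R quarter_turn (edge_dir X p e)"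
    "\<And>e v. e \<in> edges X \<Longrightarrow> v \<in> verts X \<Longrightarrow> bd_cell X v e \<Longrightarrow>
       Poly_Mapping.lookup (boundary X c) e
       = - (Poly_Mapping.lookup w e *\<^sub>R quarter_turn (edge_dir X p e)) \<bullet> p v"
proof -
  define n where "n e = quarter_turn (edge_dir X p e)" for e
  \<comment> \<open>Any end of \<open>e\<close> gives the same value.\<close>
  define m3 where "m3 e = - (n e \<bullet> p (SOME v. v \<in> verts X \<and> bd_cell X v e))" for e
  have m3: "m3 e = - (n e \<bullet> p v)" if e: "e \<in> edges X" "v \<in> verts X" "bd_cell X v e" for e v
  proof -
    let ?v = "SOME v. v \<in> verts X \<and> bd_cell X v e"
    have "?v \<in> verts X \<and> bd_cell X ?v e"
      using e by (intro someI[of "\<lambda>v. v \<in> verts X \<and> bd_cell X v e" v]) blast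
    then show ?thesis using normal_ends[OF e(1) _ e(2) _ e(3), of ?v p] by (simp add: m3_def n_def)
  qed
  let ?B = "boundary X ` chains_on (faces X)"
  define S1 where "S1 = {w \<in> self_stresses X p. weighted (\<lambda>e. fst (n e)) w \<in> ?B}"
  define S2 where "S2 = {w \<in> S1. weighted (\<lambda>e. snd (n e)) w \<in> ?B}"
  define S3 where "S3 = {w \<in> S2. weighted m3 w \<in> ?B}"
  have lin: "\<exists>L'. linear L' \<and> (\<forall>e\<in>edges X. bd_cell X v e \<longrightarrow> L (n e) = L' (edge_dir X p e))"
    if "linear L" for L :: "real \<times> real \<Rightarrow> real" and v
    using linear_compose[OF linear_quarter_turn that] by (auto simp: n_def)
  note 1 = dim_weighted_boundaries[OF subspace_self_stresses subset_refl
      lin[OF linear_fst], folded S1_def]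
  have "S1 \<subseteq> self_stresses X p" by (auto simp: S1_def)
  note 2 = dim_weighted_boundaries[OF 1(1) this lin[OF linear_snd], folded S2_def]
  have 3: "dim S2 \<le> dim S3 + 2 * g"
    unfolding S3_def
  proof (rule dim_weighted_boundaries(2)[OF 2(1)])
    show "S2 \<subseteq> self_stresses X p" by (auto simp: S1_def S2_def)
    fix v assume v: "v \<in> verts X"
    have "linear (\<lambda>z. - (quarter_turn z \<bullet> p v))"
      by (rule linearI) (simp_all add: linear_add[OF linear_quarter_turn]
          linear_scale[OF linear_quarter_turn] inner_add_left)
    then show "\<exists>L. linear L \<and> (\<forall>e\<in>edges X. bd_cell X v e \<longrightarrow> m3 e = L (edge_dir X p e))"
      using m3 v unfolding n_def by (intro exI[of _ "\<lambda>z. - (quarter_turn z \<bullet> p v)"]) auto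
  qed
  have "\<not> S3 \<subseteq> {0}"
  proof
    assume "S3 \<subseteq> {0}"
    then have "dim S3 = 0" using dim_le_card[of S3 "{}"] by simp
    then show False using 1 2 3 assms by linarith
  qed
  then obtain w where w: "w \<in> S3" "w \<noteq> 0" by blast
  have "weighted (\<lambda>e. fst (n e)) w \<in> ?B" "weighted (\<lambda>e. snd (n e)) w \<in> ?B" "weighted m3 w \<in> ?B"
    using w(1) by (simp_all add: S3_def S2_def S1_def)
  then obtain a b c where
    abc: "a \<in> chains_on (faces X)" "b \<in> chains_on (faces X)" "c \<in> chains_on (faces X)" and
    bdry: "weighted (\<lambda>e. fst (n e)) w = boundary X a" "weighted (\<lambda>e. snd (n e)) w = boundary X b"
      "weighted m3 w = boundary X c" by (elim imageE) (rule that)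
  show ?thesis
  proof (rule that[of w a b c])
    show "w \<in> self_stresses X p" using w by (auto simp: S3_def S2_def S1_def)
    show "(Poly_Mapping.lookup (boundary X a) e, Poly_Mapping.lookup (boundary X b) e)
       = Poly_Mapping.lookup w e *\<^sub>R quarter_turn (edge_dir X p e)" for e
      unfolding bdry[symmetric] n_def[symmetric] by (simp add: prod_eq_iff)
    show "Poly_Mapping.lookup (boundary X c) e
       = - (Poly_Mapping.lookup w e *\<^sub>R quarter_turn (edge_dir X p e)) \<bullet> p v"
      if "e \<in> edges X" "v \<in> verts X" "bd_cell X v e" for e v
      unfolding bdry[symmetric] n_def[symmetric] using m3[OF that] by simp
  qed (use w abc in \<open>simp_all\<close>)
qed

end

theorem mainTheorem3:
  fixes X :: "'a cell_complex"
    and p :: "'a set \<Rightarrow> real \<times> real"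
    and g :: nat
  assumes "oriented_surface_decomposition X g"
    and "diagram X p"
    and "dim (self_stresses X p) > 6 * g"
  shows "\<exists>w \<in> self_stresses X p. \<exists>h.
           polyhedral_lifting X p h \<and> nontrivial_lifting X h \<and>
           (\<forall>e \<in> edges X. \<forall>f \<in> faces X. \<forall>k \<in> faces X.
              f \<noteq> k \<and> bd_cell X e f \<and> bd_cell X e k \<longrightarrow>
              (\<forall>x. of_int (incid X e f) *\<^sub>R (gradient (h f) x - gradient (h k) x) =
                   Poly_Mapping.lookup w e *\<^sub>R quarter_turn (edge_dir X p e)))"
proof -
  interpret surface_decomposition X g by unfold_locales (rule assms(1))
  obtain w a b c where w: "w \<in> self_stresses X p" "w \<noteq> 0"
    and abc: "a \<in> chains_on (faces X)" "b \<in> chains_on (faces X)" "c \<in> chains_on (faces X)"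
    and ab: "\<And>e. e \<in> edges X \<Longrightarrow> 
       (Poly_Mapping.lookup (boundary X a) e, Poly_Mapping.lookup (boundary X b) e)
       = Poly_Mapping.lookup w e *\<^sub>R quarter_turn (edge_dir X p e)"
    and c: "\<And>e v. e \<in> edges X \<Longrightarrow> v \<in> verts X \<Longrightarrow> bd_cell X v e \<Longrightarrow>
       Poly_Mapping.lookup (boundary X c) e
       = - (Poly_Mapping.lookup w e *\<^sub>R quarter_turn (edge_dir X p e)) \<bullet> p v"
    by (rule bounding_stress[OF assms(3)]) (rule that)
  define s where "s f = (Poly_Mapping.lookup a f, Poly_Mapping.lookup b f)" for f
  define h where "h f = (\<lambda>x. s f \<bullet> x + Poly_Mapping.lookup c f)" for f
  have grad: "gradient (h f) x = s f" for f x
    unfolding h_def by (rule gradient_affine)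
  have slope: "of_int (incid X e f) *\<^sub>R (s f - s k)
      = Poly_Mapping.lookup w e *\<^sub>R quarter_turn (edge_dir X p e)"
    if e: "e \<in> edges X" "f \<in> faces X" "k \<in> faces X" "f \<noteq> k" "bd_cell X e f" "bd_cell X e k" for e f k
    using ab[OF e(1)] boundary_edge_difference[OF e abc(1)] boundary_edge_difference[OF e abc(2)]
    by (simp add: s_def)
  have "polyhedral_lifting X p h"
    unfolding polyhedral_lifting_def
  proof (intro conjI ballI impI)
    show "affine_function (h f)" for f
      unfolding affine_function_def h_def by blast
    fix e f k v assume e: "e \<in> edges X" "f \<in> faces X" "k \<in> faces X" and v: "v \<in> verts X"
      and bd: "bd_cell X e f \<and> bd_cell X e k \<and> bd_cell X v e"
    show "h f (p v) = h k (p v)"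
    proof (cases "f = k")
      case False
      let ?i = "of_int (incid X e f) :: real"
      have "?i * (h f (p v) - h k (p v))
          = (?i *\<^sub>R (s f - s k)) \<bullet> p v + ?i * (Poly_Mapping.lookup c f - Poly_Mapping.lookup c k)"
        by (simp add: h_def inner_diff_left algebra_simps)
      also have "\<dots> = 0"
        using slope[OF e False] bd boundary_edge_difference[OF e False _ _ abc(3)] c[OF e(1) v]
        by simp
      finally have "?i * (h f (p v) - h k (p v)) = 0" .
      moreover have "incid X e f \<noteq> 0"
        using e bd by (subst incid_eq_0_iff) (auto simp: edges_def faces_def)
      ultimately show ?thesis by simp
    qed simp
  qed
  moreover have "nontrivial_lifting X h"
  proof (rule ccontr)
    assume "\<not> nontrivial_lifting X h"
    then have same: "h f = h k" if "f \<in> faces X" "k \<in> faces X" for f k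
      using that unfolding nontrivial_lifting_def by blast
    have "Poly_Mapping.lookup w e = 0" if e: "e \<in> edges X" for e
    proof -
      obtain f k where fk: "f \<noteq> k" "{x \<in> faces X. bd_cell X e x} = {f, k}"
        using edge_faces[OF e] .
      then have faces: "f \<in> faces X" "k \<in> faces X" "bd_cell X e f" "bd_cell X e k" by blast+
      then have "s f = s k" using same grad by metis
      then have "Poly_Mapping.lookup w e *\<^sub>R quarter_turn (edge_dir X p e) = 0"
        using slope[OF e faces(1,2) fk(1) faces(3,4)] by simp
      then show ?thesis
        using edge_dir_nonzero[OF assms(2) e] by (simp add: quarter_turn_eq_0)
    qed
    then have "w = 0" using w(1) by (intro poly_mapping_eqI) (auto simp: self_stresses_iff chains_iff)
    with w(2) show False by simp
  qed
  ultimately show ?thesis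
    using w(1) slope grad by (intro bexI[of _ w] exI[of _ h]) auto
qed

end
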